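(* Let $\boldsymbol{\delta},\boldsymbol{\delta}'\in\mathbb{R}^{np}$, $\mathbf{\Omega}=\mathbf{V}\otimes\boldsymbol{\Sigma}$, $\mathbf{\Omega}'=\mathbf{V}'\otimes\boldsymbol{\Sigma}'$, with $\mathbf{V},\mathbf{V}'$ ($p\times p$) and $\boldsymbol{\Sigma},\boldsymbol{\Sigma}'$ ($n\times n$) positive definite, and let $\overline{\mathbf{\Omega}}=(\overline{\omega}_{ij})$, $\overline{\mathbf{\Omega}'}=(\overline{\omega}'_{ij})$ be the correlation matrices associated with $\mathbf{\Omega},\mathbf{\Omega}'$. Let $\boldsymbol{X}_0\sim SN_{n\times p}(\boldsymbol{0}_{n\times p},\overline{\mathbf{\Omega}},*,\boldsymbol{\delta})$ and $\boldsymbol{Y}_0\sim SN_{n\times p}(\boldsymbol{0}_{n\times p},\overline{\mathbf{\Omega}'},*,\boldsymbol{\delta}')$. Then $\boldsymbol{X}_0\le_{sm}\boldsymbol{Y}_0$ if and only if $\boldsymbol{X}_0$ and $\boldsymbol{Y}_0$ have the same marginals (i.e. for every $(k,j)$ the $(k,j)$ entries of $\boldsymbol{X}_0$ and $\boldsymbol{Y}_0$ have the same distribution) and $\overline{\omega}_{ij}\le\overline{\omega}'_{ij}$ for all $i,j\in\{1,\dots,np\}$.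
   Context: Notation: $\mathrm{vec}$ stacks the columns of a matrix into one column vector, $\otimes$ is the Kronecker product. Multivariate skew-normal: for a positive definite $m\times m$ matrix $\mathbf{\Omega}=(\omega_{ij})$ put $\boldsymbol{\omega}=\mathrm{diag}\{\sqrt{\omega_{11}},\dots,\sqrt{\omega_{mm}}\}$ and let $\overline{\mathbf{\Omega}}=\boldsymbol{\omega}^{-1}\mathbf{\Omega}\boldsymbol{\omega}^{-1}$ be the associated correlation matrix. For $\boldsymbol{\mu},\boldsymbol{\alpha}\in\mathbb{R}^m$, $SN_m(\boldsymbol{\mu},\mathbf{\Omega},\boldsymbol{\alpha})$ is the distribution with density $2\phi_m(\boldsymbol{z};\boldsymbol{\mu},\mathbf{\Omega})\Phi(\boldsymbol{\alpha}^T\boldsymbol{\omega}^{-1}(\boldsymbol{z}-\boldsymbol{\mu}))$, where $\phi_m(\cdot;\boldsymbol{\mu},\mathbf{\Omega})$ is the $N_m(\boldsymbol{\mu},\mathbf{\Omega})$ density and $\Phi$ the standard normal distribution function. Its parameter $\boldsymbol{\delta}$ is $\boldsymbol{\delta}=(1+\boldsymbol{\alpha}^T\overline{\mathbf{\Omega}}\boldsymbol{\alpha})^{-1/2}\boldsymbol{\omega}\overline{\mathbf{\Omega}}\boldsymbol{\alpha}$; it satisfies $\boldsymbol{\delta}^T\mathbf{\Omega}^{-1}\boldsymbol{\delta}<1$ and determines $\boldsymbol{\alpha}=(1-\boldsymbol{\delta}^T\mathbf{\Omega}^{-1}\boldsymbol{\delta})^{-1/2}\boldsymbol{\omega}\mathbf{\Omega}^{-1}\boldsymbol{\delta}$.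 One writes $SN_m(\boldsymbol{\mu},\mathbf{\Omega},\boldsymbol{\alpha},\boldsymbol{\delta})$, with $*$ in place of $\boldsymbol{\alpha}$ or $\boldsymbol{\delta}$ when it is not displayed. Matrix variate skew-normal: an $n\times p$ random matrix satisfies $\boldsymbol{Z}\sim SN_{n\times p}(\mathbf{M},\mathbf{\Omega},\mathbf{B},\boldsymbol{\delta})$ iff $\mathrm{vec}(\boldsymbol{Z})\sim SN_{np}(\mathrm{vec}(\mathbf{M}),\mathbf{\Omega},\mathrm{vec}(\mathbf{B}),\boldsymbol{\delta})$; $*$ in place of $\mathbf{B}$ means it is the skewness parameter determined by $\boldsymbol{\delta}$ and the scale matrix (writing such a distribution presupposes that $\boldsymbol{\delta}$ is admissible for the scale matrix, i.e. the quadratic form of $\boldsymbol{\delta}$ in the inverse scale matrix is $<1$). Supermodular order: for $f:\mathbb{R}^{n\times p}\to\mathbb{R}$ and $\epsilon>0$ put $\Delta_{i,j}^{\epsilon}f(\mathbf{X})=f(\mathbf{X}+\epsilon\mathbf{E}_{i,j})-f(\mathbf{X})$, where $\mathbf{E}_{i,j}$ is the $(i,j)$-th unit basis matrix of $\mathbb{R}^{n\times p}$. The function $f$ is supermodular if $\Delta_{k,i}^{\epsilon}\Delta_{l,j}^{\eta}f(\mathbf{X})\ge0$ for all $\mathbf{X}\in\mathbb{R}^{n\times p}$, all $k,l\in\{1,\dots,n\}$, $i,j\in\{1,\dots,p\}$ with $(k,i)\ne(l,j)$, and all $\epsilon,\eta>0$. $\boldsymbol{X}\le_{sm}\boldsymbol{Y}$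 means $Ef(\boldsymbol{X})\le Ef(\boldsymbol{Y})$ for all supermodular measurable functions $f$ for which the expectations are well defined. *)

theory Defs
  imports "HOL-Probability.Probability"
begin

definition positive_definite :: "real^'m^'m \<Rightarrow> bool" where
  "positive_definite A \<longleftrightarrow> transpose A = A \<and> (\<forall>x. x \<noteq> 0 \<longrightarrow> x \<bullet> (A *v x) > 0)"

text \<open>
  An \<open>n \<times> p\<close> matrix is \<open>X :: real^'p^'n\<close> (entry \<open>X $ k $ j\<close>, row \<open>k\<close>, column \<open>j\<close>).
  The index set of \<open>R^(np)\<close> is the product type \<open>'p \<times> 'n\<close>: position \<open>(j, k)\<close> of the stacked
  vector is row \<open>k\<close> of column \<open>j\<close>, the column index being the outer (block) index.
  Correspondingly the Kronecker product \<open>A \<otimes> B\<close> has blocks \<open>a\<^sub>i\<^sub>j B\<close>, with the block index first.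
\<close>

definition vec_stack :: "real^'p^'n \<Rightarrow> real^('p \<times> 'n)" where
  "vec_stack X = (\<chi> i. X $ snd i $ fst i)"

definition vec_unstack :: "real^('p \<times> 'n) \<Rightarrow> real^'p^'n" where
  "vec_unstack x = (\<chi> k j. x $ (j, k))"

definition kronecker :: "real^'b^'a \<Rightarrow> real^'d^'c \<Rightarrow> real^('b \<times> 'd)^('a \<times> 'c)" where
  "kronecker A B = (\<chi> i j. A $ fst i $ fst j * B $ snd i $ snd j)"

lemma vec_stack_unstack [simp]: "vec_stack (vec_unstack x) = x"
  by (simp add: vec_stack_def vec_unstack_def vec_eq_iff)

lemma vec_unstack_stack [simp]: "vec_unstack (vec_stack X) = X"
  by (simp add: vec_stack_def vec_unstack_def vec_eq_iff)

lemma vec_stack_matrix_mult: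
  "vec_stack (A ** X ** transpose B) = kronecker B A *v vec_stack X"
proof -
  have "(\<Sum>l\<in>UNIV. (\<Sum>k\<in>UNIV. A $ a $ k * X $ k $ l) * B $ b $ l) =
        (\<Sum>i\<in>UNIV. B $ b $ fst i * A $ a $ snd i * X $ snd i $ fst i)" for a b
    by (simp add: UNIV_Times_UNIV [symmetric] sum.cartesian_product' sum_distrib_left
        sum_distrib_right mult_ac del: UNIV_Times_UNIV)
  then show ?thesis
    by (simp add: vec_stack_def kronecker_def vec_eq_iff matrix_matrix_mult_def
        matrix_vector_mult_def transpose_def)
qed

definition scale_diag :: "real^'m^'m \<Rightarrow> real^'m^'m" where
  "scale_diag \<Omega> = (\<chi> i j. if i = j then sqrt (\<Omega> $ i $ i) else 0)"

definition correlation_matrix :: "real^'m^'m \<Rightarrow> real^'m^'m" where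
  "correlation_matrix \<Omega> = matrix_inv (scale_diag \<Omega>) ** \<Omega> ** matrix_inv (scale_diag \<Omega>)"

definition mvn_density :: "real^'m \<Rightarrow> real^'m^'m \<Rightarrow> real^'m \<Rightarrow> real" where
  "mvn_density \<mu> \<Omega> z =
     exp (- ((z - \<mu>) \<bullet> (matrix_inv \<Omega> *v (z - \<mu>))) / 2) / sqrt ((2 * pi) ^ CARD('m) * det \<Omega>)"

definition sn_density :: "real^'m \<Rightarrow> real^'m^'m \<Rightarrow> real^'m \<Rightarrow> real^'m \<Rightarrow> real" where
  "sn_density \<mu> \<Omega> \<alpha> z =
     2 * mvn_density \<mu> \<Omega> z *
     cdf std_normal_distribution (\<alpha> \<bullet> (matrix_inv (scale_diag \<Omega>) *v (z - \<mu>)))"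

definition sn_delta :: "real^'m^'m \<Rightarrow> real^'m \<Rightarrow> real^'m" where
  "sn_delta \<Omega> \<alpha> =
     (1 / sqrt (1 + \<alpha> \<bullet> (correlation_matrix \<Omega> *v \<alpha>))) *\<^sub>R
     (scale_diag \<Omega> *v (correlation_matrix \<Omega> *v \<alpha>))"

definition sn_admissible :: "real^'m^'m \<Rightarrow> real^'m \<Rightarrow> bool" where
  "sn_admissible \<Omega> \<delta> \<longleftrightarrow> \<delta> \<bullet> (matrix_inv \<Omega> *v \<delta>) < 1"

definition sn_alpha :: "real^'m^'m \<Rightarrow> real^'m \<Rightarrow> real^'m" where
  "sn_alpha \<Omega> \<delta> =
     (1 / sqrt (1 - \<delta> \<bullet> (matrix_inv \<Omega> *v \<delta>))) *\<^sub>R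
     (scale_diag \<Omega> *v (matrix_inv \<Omega> *v \<delta>))"

definition skew_normal ::
  "'a measure \<Rightarrow> ('a \<Rightarrow> real^'m) \<Rightarrow> real^'m \<Rightarrow> real^'m^'m \<Rightarrow> real^'m \<Rightarrow> real^'m \<Rightarrow> bool" where
  "skew_normal P Z \<mu> \<Omega> \<alpha> \<delta> \<longleftrightarrow>
     positive_definite \<Omega> \<and> \<delta> = sn_delta \<Omega> \<alpha> \<and>
     distributed P lborel Z (\<lambda>z. ennreal (sn_density \<mu> \<Omega> \<alpha> z))"

definition matrix_skew_normal ::
  "'a measure \<Rightarrow> ('a \<Rightarrow> real^'p^'n) \<Rightarrow> real^'p^'n \<Rightarrow> real^('p \<times> 'n)^('p \<times> 'n) \<Rightarrow>
   real^'p^'n \<Rightarrow> real^('p \<times> 'n) \<Rightarrow> bool" where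
  "matrix_skew_normal P Z M \<Omega> B \<delta> \<longleftrightarrow>
     skew_normal P (\<lambda>w. vec_stack (Z w)) (vec_stack M) \<Omega> (vec_stack B) \<delta>"

text \<open>The distribution \<open>SN(M, \<Omega>, *, \<delta>)\<close>: the skewness parameter is the one determined by
  \<open>\<delta>\<close> and \<open>\<Omega>\<close>.\<close>

definition matrix_skew_normal_star ::
  "'a measure \<Rightarrow> ('a \<Rightarrow> real^'p^'n) \<Rightarrow> real^'p^'n \<Rightarrow> real^('p \<times> 'n)^('p \<times> 'n) \<Rightarrow>
   real^('p \<times> 'n) \<Rightarrow> bool" where
  "matrix_skew_normal_star P Z M \<Omega> \<delta> \<longleftrightarrow>
     sn_admissible \<Omega> \<delta> \<and> matrix_skew_normal P Z M \<Omega> (vec_unstack (sn_alpha \<Omega> \<delta>)) \<delta>"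

definition unit_matrix :: "'n \<Rightarrow> 'p \<Rightarrow> real^'p^'n" where
  "unit_matrix k j = axis k (axis j 1)"

definition entry_diff ::
  "'n \<Rightarrow> 'p \<Rightarrow> real \<Rightarrow> (real^'p^'n \<Rightarrow> real) \<Rightarrow> real^'p^'n \<Rightarrow> real" where
  "entry_diff k j \<epsilon> f X = f (X + \<epsilon> *\<^sub>R unit_matrix k j) - f X"

definition supermodular :: "(real^'p^'n \<Rightarrow> real) \<Rightarrow> bool" where
  "supermodular f \<longleftrightarrow>
     (\<forall>X k l i j \<epsilon> \<eta>. (k, i) \<noteq> (l, j) \<longrightarrow> \<epsilon> > 0 \<longrightarrow> \<eta> > 0 \<longrightarrow>
        entry_diff k i \<epsilon> (entry_diff l j \<eta> f) X \<ge> 0)"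

text \<open>The expectations are well defined when both compositions are integrable; the library's
  integral of a non-integrable function is \<open>0\<close> and carries no information.\<close>

definition supermodular_le ::
  "'a measure \<Rightarrow> ('a \<Rightarrow> real^'p^'n) \<Rightarrow> 'b measure \<Rightarrow> ('b \<Rightarrow> real^'p^'n) \<Rightarrow> bool" where
  "supermodular_le P X Q Y \<longleftrightarrow>
     (\<forall>f. supermodular f \<longrightarrow> f \<in> borel_measurable borel \<longrightarrow>
        integrable P (\<lambda>w. f (X w)) \<longrightarrow> integrable Q (\<lambda>w. f (Y w)) \<longrightarrow>
        (\<integral>w. f (X w) \<partial>P) \<le> (\<integral>w. f (Y w) \<partial>Q))"

definition same_marginals ::
  "'a measure \<Rightarrow> ('a \<Rightarrow> real^'p^'n) \<Rightarrow> 'b measure \<Rightarrow> ('b \<Rightarrow> real^'p^'n) \<Rightarrow> bool" where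
  "same_marginals P X Q Y \<longleftrightarrow>
     (\<forall>k j. distr P borel (\<lambda>w. X w $ k $ j) = distr Q borel (\<lambda>w. Y w $ k $ j))"

end

theory Submission
  imports Defs
begin

text \<open>
  The vector \<open>X\<close> with law \<open>SN(0, \<Omega>, *, \<delta>)\<close> is \<open>W + u \<delta>\<close> with independent half-normal \<open>u\<close> and Gaussian \<open>W\<close>
  of covariance \<open>\<Omega> - \<delta> \<delta>\<^sup>T\<close>, so \<open>E X = c \<delta>\<close> for a constant \<open>c > 0\<close> and \<open>E X X\<^sup>T = \<Omega>\<close>. For necessity, test
  with \<open>\<plusminus>h(x\<^sub>a)\<close> and with \<open>x\<^sub>a x\<^sub>b\<close>. For sufficiency, equal marginals give equal means, hence \<open>\<delta> = \<delta>'\<close>, and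
  conditioning on \<open>u\<close> reduces the claim to centred Gaussian laws with equal variances and ordered covariances.

  There one moves along the segment between the covariances in small steps, each increasing one covariance.
  A step replaces \<open>W + C e\<^sub>i + C' e\<^sub>j\<close> by \<open>W + C e\<^sub>i + C e\<^sub>j\<close> with \<open>C, C'\<close> independent and identically distributed,
  and supermodularity gives \<open>F(C, C) + F(C', C') \<ge> F(C, C') + F(C', C)\<close>.

  The intermediate laws can have heavier tails than both end points, so the test function need not be integrable
  along the segment. It is therefore first composed with the coordinatewise inverse of \<open>y \<mapsto> y (1 + \<kappa> ln (1 + y\<^sup>2))\<close>:
  this preserves supermodularity, makes it integrable under every Gaussian law, and is undone by
  dominated convergence as \<open>\<kappa> \<rightarrow> 0\<close>.
\<close>

section \<open>Positive definite matrices and rank-one downdates\<close>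

text \<open>Two obstacles shape the proof. The test function F is only measurable, so
  \<open>F (shrink_vec \<kappa> x)\<close> need not tend to \<open>F x\<close> as \<kappa> tends to
  0. Substituting \<open>x = stretch_vec \<kappa> y\<close> leaves F untouched and moves \<kappa>
  into the Gaussian density and the Jacobian, which are continuous in \<kappa>. What remains is to
  bound this new weight by a multiple of a Gaussian density. The logarithm answers two demands on
  the stretched quadratic form. It must outgrow every multiple of |y|^2, so that any two covariances
  can be compared, and it may fall below the original form by a bounded amount only, so that the
  bound is uniform for small \<kappa>. A coordinatewise map bends directions, and a power in place
  of the logarithm can lower a correlated form; the logarithm varies so slowly that the bending is
  of order |y|. On the probabilistic side, one factorisation of the joint density of W + u v and u
  serves for the sums of Gaussians, the second moments and the mixture form of the skew-normal law.
  Normalising constants are compared by total mass, so no determinant is evaluated.\<close>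

lemma inner_symmetric_matrix:
  fixes A :: "real^'m^'m"
  assumes "transpose A = A"
  shows "x \<bullet> (A *v y) = y \<bullet> (A *v x)"
  by (metis assms dot_lmul_matrix inner_commute transpose_matrix_vector)

lemma positive_definite_sym: "positive_definite A \<Longrightarrow> x \<bullet> (A *v y) = y \<bullet> (A *v x)"
  by (simp add: positive_definite_def inner_symmetric_matrix)

lemma positive_definite_nonneg: "positive_definite A \<Longrightarrow> 0 \<le> x \<bullet> (A *v x)"
  by (cases "x = 0") (auto simp: positive_definite_def intro: less_imp_le)

lemma positive_definite_invertible:
  fixes A :: "real^'m^'m"
  assumes "positive_definite A"
  shows "invertible A"
proof -
  have "x = 0" if "A *v x = 0" for x
    using assms that by (metis inner_zero_right less_irrefl positive_definite_def)
  then show ?thesis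
    using matrix_left_invertible_ker invertible_left_inverse by blast
qed

lemma matrix_inv_vector_cancel:
  fixes A :: "real^'m^'m"
  assumes "positive_definite A"
  shows "matrix_inv A *v (A *v x) = x" "A *v (matrix_inv A *v x) = x"
proof -
  have "A ** matrix_inv A = mat 1 \<and> matrix_inv A ** A = mat 1"
    using positive_definite_invertible[OF assms] unfolding invertible_def matrix_inv_def
    by (rule someI_ex)
  then show "matrix_inv A *v (A *v x) = x" "A *v (matrix_inv A *v x) = x"
    by (simp_all add: matrix_vector_mul_assoc)
qed

lemma positive_definite_matrix_inv:
  fixes A :: "real^'m^'m"
  assumes "positive_definite A"
  shows "positive_definite (matrix_inv A)"
proof -
  note c = matrix_inv_vector_cancel[OF assms]
  have "x \<bullet> (matrix_inv A *v y) = (matrix_inv A *v x) \<bullet> y" for x y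
    by (metis c(2) assms inner_commute positive_definite_sym)
  then have "transpose (matrix_inv A) = matrix_inv A"
    by (metis (no_types, opaque_lifting) adjoint_matrix adjoint_unique matrix_of_matrix_vector_mul)
  moreover have "0 < x \<bullet> (matrix_inv A *v x)" if "x \<noteq> 0" for x
    using assms that c(2)[of x]
    by (metis inner_commute matrix_vector_mult_0_right positive_definite_def)
  ultimately show ?thesis
    by (simp add: positive_definite_def)
qed

lemma matrix_form_bound:
  fixes A :: "real^'m^'m"
  obtains C where "C \<ge> 0" "\<And>x y. \<bar>x \<bullet> (A *v y)\<bar> \<le> C * norm x * norm y"
proof -
  have "\<bar>x \<bullet> (A *v y)\<bar> \<le> onorm ((*v) A) * norm x * norm y" for x y
  proof -
    have "norm x * norm (A *v y) \<le> norm x * (onorm ((*v) A) * norm y)"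
      by (intro mult_left_mono onorm matrix_vector_mul_bounded_linear) simp
    with Cauchy_Schwarz_ineq2[of x "A *v y"] show ?thesis
      by (simp add: mult_ac)
  qed
  moreover have "0 \<le> onorm ((*v) A)"
    by (intro onorm_pos_le matrix_vector_mul_bounded_linear)
  ultimately show ?thesis using that by blast
qed

lemma positive_definite_lower_bound:
  fixes A :: "real^'m^'m"
  assumes "positive_definite A"
  obtains c where "c > 0" "\<And>x. c * (norm x)\<^sup>2 \<le> x \<bullet> (A *v x)"
proof -
  let ?S = "sphere (0::real^'m) 1"
  have ne: "?S \<noteq> {}" by simp
  have cont: "continuous_on ?S (\<lambda>x. x \<bullet> (A *v x))"
    by (intro continuous_intros linear_continuous_on matrix_vector_mul_bounded_linear)
  obtain z where z: "z \<in> ?S" "\<And>x. x \<in> ?S \<Longrightarrow> z \<bullet> (A *v z) \<le> x \<bullet> (A *v x)"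
    using continuous_attains_inf[OF compact_sphere ne cont] by blast
  have "z \<noteq> 0" using z(1) by auto
  then have pos: "z \<bullet> (A *v z) > 0" using assms by (simp add: positive_definite_def)
  moreover have "(z \<bullet> (A *v z)) * (norm x)\<^sup>2 \<le> x \<bullet> (A *v x)" for x
  proof (cases "x = 0")
    case False
    then have "x /\<^sub>R norm x \<in> ?S" by simp
    from z(2)[OF this] have "z \<bullet> (A *v z) \<le> (x \<bullet> (A *v x)) / (norm x)\<^sup>2"
      by (simp add: matrix_vector_mult_scaleR power2_eq_square divide_simps)
    then show ?thesis using False by (simp add: field_simps)
  qed simp
  ultimately show ?thesis using that by blast
qed

section \<open>Rank-one matrices and admissibility\<close>

definition outer_square :: "real^'m \<Rightarrow> real^'m^'m" where
  "outer_square v = (\<chi> i j. v $ i * v $ j)"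

lemma outer_square_vector: "outer_square v *v x = (v \<bullet> x) *\<^sub>R v"
  by (simp add: outer_square_def vec_eq_iff matrix_vector_mult_def inner_vec_def sum_distrib_left mult_ac)

lemma transpose_outer_square: "transpose (outer_square v) = outer_square v"
  by (simp add: outer_square_def transpose_def vec_eq_iff mult_ac)

lemma transpose_add: "transpose (A + B) = transpose A + transpose (B :: real^'m^'n)"
  by (simp add: transpose_def vec_eq_iff)

lemma transpose_diff: "transpose (A - B) = transpose A - transpose (B :: real^'m^'n)"
  by (simp add: transpose_def vec_eq_iff)

lemma positive_definite_add_outer_square:
  assumes "positive_definite A"
  shows "positive_definite (A + outer_square v)"
proof -
  have "0 < x \<bullet> (A *v x) + (v \<bullet> x) * (v \<bullet> x)" if "x \<noteq> 0" for x
    using assms that by (intro add_pos_nonneg) (auto simp: positive_definite_def)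
  then show ?thesis using assms
    by (simp add: positive_definite_def transpose_add transpose_outer_square
        matrix_vector_mult_add_rdistrib outer_square_vector inner_add_right inner_commute)
qed

text \<open>Cauchy-Schwarz for the form of A bounds the square of v . x by (v . A^-1 v)(x . A x),
  with equality at x = A^-1 v. Admissibility of v is thus exactly the condition under which v v^T
  can be split off the covariance A, leaving a nondegenerate Gaussian.\<close>

lemma sn_admissible_iff_positive_definite:
  assumes "positive_definite A"
  shows "sn_admissible A v \<longleftrightarrow> positive_definite (A - outer_square v)"
proof
  let ?w = "matrix_inv A *v v"
  let ?q = "v \<bullet> ?w"
  note c = matrix_inv_vector_cancel[OF assms]
  have form: "x \<bullet> ((A - outer_square v) *v x) = x \<bullet> (A *v x) - (v \<bullet> x)\<^sup>2" for x
    by (simp add: matrix_vector_mult_diff_rdistrib outer_square_vector inner_diff_right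
        inner_commute power2_eq_square)
  have tr: "transpose (A - outer_square v) = A - outer_square v"
    using assms by (simp add: positive_definite_def transpose_diff transpose_outer_square)
  {
    assume "sn_admissible A v"
    then have q: "?q < 1" by (simp add: sn_admissible_def)
    have "0 < x \<bullet> (A *v x) - (v \<bullet> x)\<^sup>2" if x: "x \<noteq> 0" for x
    proof -
      let ?a = "x \<bullet> (A *v x)" and ?b = "v \<bullet> x"
      have xa: "?a > 0" using assms x by (simp add: positive_definite_def)
      \<comment> \<open>Nonnegativity of the form at this combination is the discriminant argument
        for Cauchy-Schwarz, cleared of denominators.\<close>
      let ?y = "?a *\<^sub>R ?w - ?b *\<^sub>R x"
      have Aw: "A *v ?w = v" by (rule c)
      have "x \<bullet> v = v \<bullet> x" "?w \<bullet> v = ?q" "?w \<bullet> (A *v x) = ?b"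
        using positive_definite_sym[OF assms, of ?w x] by (simp_all add: inner_commute Aw)
      then have "?y \<bullet> (A *v ?y) = ?a * (?a * ?q - ?b\<^sup>2)"
        by (simp add: matrix_vector_mult_diff_distrib matrix_vector_mult_scaleR Aw
            inner_diff_left inner_diff_right algebra_simps power2_eq_square)
      moreover have "0 \<le> ?y \<bullet> (A *v ?y)" by (rule positive_definite_nonneg[OF assms])
      ultimately have "?b\<^sup>2 \<le> ?a * ?q" using xa by (simp add: zero_le_mult_iff)
      also have "\<dots> < ?a" using xa q by simp
      finally show ?thesis by simp
    qed
    then show "positive_definite (A - outer_square v)"
      using tr form by (simp add: positive_definite_def)
  next
    assume pd: "positive_definite (A - outer_square v)"
    show "sn_admissible A v"
    proof (cases "?w = 0")
      case False
      then have "0 < ?w \<bullet> (A *v ?w) - (v \<bullet> ?w)\<^sup>2"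
        using pd form unfolding positive_definite_def by metis
      then have "0 < ?q * (1 - ?q)" 
        by (simp add: c inner_commute power2_eq_square algebra_simps)
      moreover have "0 \<le> ?q" by (rule positive_definite_nonneg[OF positive_definite_matrix_inv[OF assms]])
      ultimately show ?thesis by (auto simp: sn_admissible_def zero_less_mult_iff)
    qed (simp add: sn_admissible_def)
  }
qed

text \<open>Sherman-Morrison inverts \<open>A - outer_square v\<close>, and completing the square in
  u does the rest. The two sides are the exponents of the joint density of z = W + u v and u:
  independent factors on the left, on the right the law of z and the law of u given z, with
  conditional mean v . A^-1 z and variance 1 - q.\<close>

lemma rank_one_downdate_form:
  fixes A :: "real^'m^'m"
  assumes A: "positive_definite A" and B: "positive_definite (A - outer_square v)"
  defines "q \<equiv> v \<bullet> (matrix_inv A *v v)"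
  shows "(z - u *\<^sub>R v) \<bullet> (matrix_inv (A - outer_square v) *v (z - u *\<^sub>R v)) + u\<^sup>2 =
    z \<bullet> (matrix_inv A *v z) + (u - v \<bullet> (matrix_inv A *v z))\<^sup>2 / (1 - q)"
proof -
  let ?L = "matrix_inv A" and ?B = "A - outer_square v"
  note c = matrix_inv_vector_cancel[OF A]
  note sym = positive_definite_sym[OF positive_definite_matrix_inv[OF A]]
  have q: "q < 1" using A B sn_admissible_iff_positive_definite unfolding q_def sn_admissible_def by blast
  have inv: "matrix_inv ?B *v x = ?L *v x + ((v \<bullet> (?L *v x)) / (1 - q)) *\<^sub>R (?L *v v)" for x
  proof -
    let ?y = "?L *v x + ((v \<bullet> (?L *v x)) / (1 - q)) *\<^sub>R (?L *v v)"
    let ?s = "v \<bullet> (?L *v x)"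
    have "?B *v ?y = x + ((?s / (1 - q)) - (?s + (?s / (1 - q)) * q)) *\<^sub>R v"
      by (simp add: matrix_vector_mult_diff_rdistrib matrix_vector_right_distrib matrix_vector_mult_scaleR c outer_square_vector
          inner_add_right q_def[symmetric] algebra_simps)
    also have "(?s / (1 - q)) - (?s + (?s / (1 - q)) * q) = 0"
      using q by (simp add: field_simps)
    finally have "?B *v ?y = x" by simp
    then show ?thesis by (metis matrix_inv_vector_cancel(1)[OF B])
  qed
  let ?a = "v \<bullet> (?L *v z)"
  have e1: "(z - u *\<^sub>R v) \<bullet> (?L *v (z - u *\<^sub>R v)) = z \<bullet> (?L *v z) - 2 * u * ?a + u\<^sup>2 * q"
    using sym[of z v]
    by (simp add: matrix_vector_mult_diff_distrib matrix_vector_mult_scaleR inner_diff_left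
        inner_diff_right q_def power2_eq_square algebra_simps)
  have e2: "v \<bullet> (?L *v (z - u *\<^sub>R v)) = ?a - u * q"
    by (simp add: matrix_vector_mult_diff_distrib matrix_vector_mult_scaleR inner_diff_right q_def)
  have e3: "(z - u *\<^sub>R v) \<bullet> (?L *v v) = ?a - u * q"
    using e2 sym[of "z - u *\<^sub>R v" v] by simp
  have "(z - u *\<^sub>R v) \<bullet> (matrix_inv ?B *v (z - u *\<^sub>R v)) + u\<^sup>2 =
     z \<bullet> (?L *v z) - 2 * u * ?a + u\<^sup>2 * q + (?a - u * q)\<^sup>2 / (1 - q) + u\<^sup>2"
    unfolding inv inner_add_right e1 inner_scaleR_right e2 e3 by (simp add: power2_eq_square)
  also have "\<dots> = z \<bullet> (?L *v z) + (u - ?a)\<^sup>2 / (1 - q)"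
    using q by (simp add: field_simps power2_eq_square)
  finally show ?thesis .
qed

section \<open>Centred Gaussian measures\<close>

definition gauss_kernel :: "real^'m^'m \<Rightarrow> real^'m \<Rightarrow> real" where
  "gauss_kernel S z = exp (- (z \<bullet> (matrix_inv S *v z)) / 2)"

text \<open>Defined as an integral and not through the determinant, so that constants of different
  covariances can be compared by Fubini.\<close>

definition gauss_norm :: "real^'m^'m \<Rightarrow> real" where
  "gauss_norm S = (\<integral>z. gauss_kernel S z \<partial>lborel)"

definition gauss_density :: "real^'m^'m \<Rightarrow> real^'m \<Rightarrow> real" where
  "gauss_density S z = gauss_kernel S z / gauss_norm S"

definition gaussian :: "real^'m^'m \<Rightarrow> (real^'m) measure" where
  "gaussian S = density lborel (\<lambda>z. ennreal (gauss_density S z))"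

lemma borel_measurable_matrix_vector [measurable]:
  "(\<lambda>x. (A::real^'n^'m) *v x) \<in> borel_measurable borel"
  by (intro borel_measurable_continuous_onI linear_continuous_on matrix_vector_mul_bounded_linear)

lemma borel_measurable_gauss_kernel [measurable]: "gauss_kernel S \<in> borel_measurable borel"
  unfolding gauss_kernel_def[abs_def] by measurable

lemma borel_measurable_gauss_density [measurable]: "gauss_density S \<in> borel_measurable borel"
  unfolding gauss_density_def[abs_def] by measurable

lemma sets_gaussian [simp, measurable_cong]: "sets (gaussian S) = sets borel"
  by (simp add: gaussian_def)

lemma space_gaussian [simp]: "space (gaussian S) = UNIV"
  by (simp add: gaussian_def)

lemma integrable_exp_neg_norm_square:
  assumes "a > 0"
  shows "integrable lborel (\<lambda>z::'a::euclidean_space. exp (- a * (norm z)\<^sup>2))"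
proof (rule integrableI_nonneg)
  have 1: "(\<integral>\<^sup>+x. ennreal (exp (- a * x\<^sup>2)) \<partial>lborel) < \<infinity>"
  proof -
    let ?s = "1 / sqrt (2 * a)"
    have s2: "?s\<^sup>2 = 1 / (2 * a)" using assms by (simp add: power_divide)
    have "exp (- a * x\<^sup>2) = sqrt (2 * pi * ?s\<^sup>2) * normal_density 0 ?s x" for x
      unfolding normal_density_def s2 using assms by (simp add: field_simps)
    moreover have "integrable lborel (\<lambda>x. sqrt (2 * pi * ?s\<^sup>2) * normal_density 0 ?s x)"
      by (intro integrable_mult_right integrable_normal_density) (use assms in simp)
    ultimately have "integrable lborel (\<lambda>x. exp (- a * x\<^sup>2))" by simp
    then show ?thesis by (simp add: nn_integral_eq_integral)
  qed
  have "ennreal (exp (- a * (norm z)\<^sup>2)) = (\<Prod>b\<in>Basis. ennreal (exp (- a * (z \<bullet> b)\<^sup>2)))" for z :: 'a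
  proof -
    have "(norm z)\<^sup>2 = (\<Sum>b\<in>Basis. (z \<bullet> b)\<^sup>2)"
      unfolding power2_norm_eq_inner by (subst euclidean_inner) (simp add: power2_eq_square)
    then show ?thesis
      by (simp add: prod_ennreal exp_sum[symmetric] sum_distrib_left sum_negf)
  qed
  then have "nn_integral lborel (\<lambda>z::'a. ennreal (exp (- a * (norm z)\<^sup>2))) =
      (\<Prod>b\<in>(Basis::'a set). (\<integral>\<^sup>+x. ennreal (exp (- a * x\<^sup>2)) \<partial>lborel))"
    by (simp only:) (subst nn_integral_lborel_prod, auto)
  also have "\<dots> < \<infinity>" using 1 by (simp add: power_less_top_ennreal)
  finally show "nn_integral lborel (\<lambda>z::'a. ennreal (exp (- a * (norm z)\<^sup>2))) < \<infinity>" .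
qed auto

lemma gauss_kernel_pos: "gauss_kernel S z > 0"
  by (simp add: gauss_kernel_def)

lemma gauss_kernel_nonneg [simp]: "gauss_kernel S z \<ge> 0"
  by (simp add: gauss_kernel_def)

lemma integrable_gauss_kernel:
  assumes "positive_definite S"
  shows "integrable lborel (gauss_kernel S)"
proof -
  obtain c where c: "c > 0" "\<And>x. c * (norm x)\<^sup>2 \<le> x \<bullet> (matrix_inv S *v x)"
    using positive_definite_lower_bound[OF positive_definite_matrix_inv[OF assms]] by metis
  show ?thesis
  proof (rule Bochner_Integration.integrable_bound)
    show "integrable lborel (\<lambda>z::real^'a. exp (- (c/2) * (norm z)\<^sup>2))"
      by (rule integrable_exp_neg_norm_square) (use c in simp)
    show "AE x in lborel. norm (gauss_kernel S x) \<le> norm (exp (- (c/2) * (norm x)\<^sup>2))"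
      using c(2) by (auto simp: gauss_kernel_def)
  qed simp
qed

lemma gauss_norm_pos:
  assumes "positive_definite S"
  shows "gauss_norm S > 0"
proof -
  have "gauss_norm S \<noteq> 0"
  proof
    assume "gauss_norm S = 0"
    then have "AE x in lborel. gauss_kernel S x = 0"
      unfolding gauss_norm_def
      using integral_nonneg_eq_0_iff_AE[OF integrable_gauss_kernel[OF assms]]
      by (simp add: gauss_kernel_pos less_imp_le)
    moreover have "(gauss_kernel S x = 0) = False" for x
      using gauss_kernel_pos[of S x] by simp
    ultimately have "AE x in (lborel :: (real^'a) measure). False" by simp
    then show False by (simp add: AE_iff_null null_sets_def emeasure_lborel_UNIV)
  qed
  moreover have "gauss_norm S \<ge> 0"
    unfolding gauss_norm_def by (rule integral_nonneg_AE) (simp add: gauss_kernel_pos less_imp_le)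
  ultimately show ?thesis by simp
qed

lemma gauss_density_pos: "positive_definite S \<Longrightarrow> gauss_density S z > 0"
  by (simp add: gauss_density_def gauss_kernel_pos gauss_norm_pos)

lemma gauss_density_nonneg: "positive_definite S \<Longrightarrow> gauss_density S z \<ge> 0"
  by (simp add: gauss_density_pos less_imp_le)

lemma integrable_gauss_density:
  "positive_definite S \<Longrightarrow> integrable lborel (gauss_density S)"
  unfolding gauss_density_def[abs_def] by (simp add: integrable_gauss_kernel)

lemma integral_gauss_density:
  assumes "positive_definite S"
  shows "(\<integral>z. gauss_density S z \<partial>lborel) = 1"
  using gauss_norm_pos[OF assms]
  by (simp add: gauss_density_def gauss_norm_def[symmetric])

lemma nn_integral_gauss_density:
  assumes "positive_definite S"
  shows "(\<integral>\<^sup>+z. gauss_density S z \<partial>lborel) = 1"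
  using assms by (simp add: nn_integral_eq_integral integrable_gauss_density integral_gauss_density
      gauss_density_nonneg)

lemma prob_space_gaussian:
  assumes "positive_definite S"
  shows "prob_space (gaussian S)"
  by (rule prob_spaceI) (simp add: gaussian_def emeasure_density nn_integral_gauss_density[OF assms])

section \<open>Disintegration of a Gaussian law along one direction\<close>

lemma nn_integral_lborel_translate:
  fixes f :: "'a::euclidean_space \<Rightarrow> ennreal"
  assumes [measurable]: "f \<in> borel_measurable borel"
  shows "(\<integral>\<^sup>+z. f (z + c) \<partial>lborel) = (\<integral>\<^sup>+z. f z \<partial>lborel)"
proof -
  have "(\<integral>\<^sup>+z. f z \<partial>lborel) = (\<integral>\<^sup>+z. f z \<partial>distr lborel borel ((+) c))"
    by (simp add: lborel_distr_plus)
  also have "\<dots> = (\<integral>\<^sup>+z. f (z + c) \<partial>lborel)"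
    by (subst nn_integral_distr) (auto simp: add.commute)
  finally show ?thesis by simp
qed

lemma gauss_kernel_downdate:
  fixes A :: "real^'m^'m"
  assumes A: "positive_definite A" and B: "positive_definite (A - outer_square v)"
  defines "s \<equiv> sqrt (1 - v \<bullet> (matrix_inv A *v v))"
  shows "gauss_kernel (A - outer_square v) (z - u *\<^sub>R v) * std_normal_density u =
    s * (gauss_kernel A z * normal_density (v \<bullet> (matrix_inv A *v z)) s u)"
proof -
  have q: "v \<bullet> (matrix_inv A *v v) < 1"
    using A B sn_admissible_iff_positive_definite sn_admissible_def by blast
  then have s: "s > 0" "1 - v \<bullet> (matrix_inv A *v v) = s\<^sup>2" by (simp_all add: s_def)
  have "gauss_kernel (A - outer_square v) (z - u *\<^sub>R v) * exp (- u\<^sup>2 / 2) =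
     gauss_kernel A z * exp (- (u - v \<bullet> (matrix_inv A *v z))\<^sup>2 / (2 * s\<^sup>2))"
    unfolding gauss_kernel_def exp_add[symmetric]
    using rank_one_downdate_form[OF A B, of z u] s by (simp add: field_simps)
  then have "gauss_kernel (A - outer_square v) (z - u *\<^sub>R v) * exp (- u\<^sup>2 / 2) / sqrt (2 * pi) =
     gauss_kernel A z * exp (- (u - v \<bullet> (matrix_inv A *v z))\<^sup>2 / (2 * s\<^sup>2)) / sqrt (2 * pi)"
    by simp
  moreover have "sqrt (2 * pi * s\<^sup>2) = s * sqrt (2 * pi)" using s by (simp add: real_sqrt_mult)
  ultimately show ?thesis using s
    by (simp add: std_normal_density_def normal_density_def)
qed

text \<open>Integrate the kernel identity over z and u in both orders. The result stands in for the
  determinant identity det (A - v v^T) = (1 - v . A^-1 v) det A.\<close>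

lemma gauss_norm_downdate:
  fixes A :: "real^'m^'m"
  assumes A: "positive_definite A" and B: "positive_definite (A - outer_square v)"
  shows "gauss_norm (A - outer_square v) = sqrt (1 - v \<bullet> (matrix_inv A *v v)) * gauss_norm A"
proof -
  let ?B = "A - outer_square v" and ?s = "sqrt (1 - v \<bullet> (matrix_inv A *v v))"
  have q: "v \<bullet> (matrix_inv A *v v) < 1"
    using A B sn_admissible_iff_positive_definite sn_admissible_def by blast
  then have s: "?s > 0" by simp
  have kern: "(\<integral>\<^sup>+z. gauss_kernel C z \<partial>lborel) = gauss_norm C" if "positive_definite C" for C :: "real^'m^'m"
    unfolding gauss_norm_def using integrable_gauss_kernel[OF that]
    by (intro nn_integral_eq_integral) (auto simp: gauss_kernel_pos less_imp_le)
  have norm1: "(\<integral>\<^sup>+u. normal_density m r u \<partial>lborel) = 1" if "r > 0" for m r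
    using that by (simp add: nn_integral_eq_integral)
  have "ennreal (gauss_norm ?B) = (\<integral>\<^sup>+u. std_normal_density u * (\<integral>\<^sup>+z. gauss_kernel ?B z \<partial>lborel) \<partial>lborel)"
    by (simp add: nn_integral_multc norm1 kern[OF B])
  also have "\<dots> = (\<integral>\<^sup>+u. \<integral>\<^sup>+z. gauss_kernel ?B (z - u *\<^sub>R v) * std_normal_density u \<partial>lborel \<partial>lborel)"
  proof (rule nn_integral_cong)
    fix u
    have "(\<integral>\<^sup>+z. gauss_kernel ?B z \<partial>lborel) = (\<integral>\<^sup>+z. gauss_kernel ?B (z - u *\<^sub>R v) \<partial>lborel)"
      using nn_integral_lborel_translate[of "\<lambda>z. ennreal (gauss_kernel ?B z)" "- (u *\<^sub>R v)"] by simp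
    moreover have "(\<integral>\<^sup>+z. gauss_kernel ?B (z - u *\<^sub>R v) * std_normal_density u \<partial>lborel) =
      std_normal_density u * (\<integral>\<^sup>+z. gauss_kernel ?B (z - u *\<^sub>R v) \<partial>lborel)"
      by (subst nn_integral_cmult[symmetric]) (simp_all add: ennreal_mult'' mult.commute)
    ultimately show "std_normal_density u * (\<integral>\<^sup>+z. gauss_kernel ?B z \<partial>lborel) =
      (\<integral>\<^sup>+z. gauss_kernel ?B (z - u *\<^sub>R v) * std_normal_density u \<partial>lborel)"
      by simp
  qed
  also have "\<dots> = (\<integral>\<^sup>+z. \<integral>\<^sup>+u. gauss_kernel ?B (z - u *\<^sub>R v) * std_normal_density u \<partial>lborel \<partial>lborel)"
    by (subst lborel_pair.Fubini') auto
  also have "\<dots> = (\<integral>\<^sup>+z. ennreal ?s * (ennreal (gauss_kernel A z) *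
      (\<integral>\<^sup>+u. normal_density (v \<bullet> (matrix_inv A *v z)) ?s u \<partial>lborel)) \<partial>lborel)"
    unfolding gauss_kernel_downdate[OF A B]
    using s by (simp add: ennreal_mult' gauss_kernel_pos less_imp_le nn_integral_cmult)
  also have "\<dots> = ennreal (?s * gauss_norm A)"
    by (simp add: norm1[OF s] nn_integral_cmult kern[OF A] ennreal_mult'' less_imp_le[OF gauss_norm_pos[OF A]])
  finally show ?thesis
    using s gauss_norm_pos[OF A] gauss_norm_pos[OF B] by (simp add: ennreal_inj)
qed

text \<open>The factor in the kernel identity is exactly the ratio of the two normalising constants,
  so it cancels and Bayes' rule for the pair of z and u remains.\<close>

lemma gauss_density_downdate:
  fixes A :: "real^'m^'m"
  assumes A: "positive_definite A" and B: "positive_definite (A - outer_square v)"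
  shows "gauss_density (A - outer_square v) (z - u *\<^sub>R v) * std_normal_density u =
    gauss_density A z *
    normal_density (v \<bullet> (matrix_inv A *v z)) (sqrt (1 - v \<bullet> (matrix_inv A *v v))) u"
proof -
  have "v \<bullet> (matrix_inv A *v v) < 1"
    using A B sn_admissible_iff_positive_definite sn_admissible_def by blast
  then show ?thesis
    using gauss_kernel_downdate[OF A B, of z u] gauss_norm_pos[OF A]
    unfolding gauss_density_def gauss_norm_downdate[OF A B]
    by (simp add: field_simps)
qed

text \<open>Both sides are the expectation of \<open>G (W + u v) u\<close> for independent \<open>W\<close> and standard normal \<open>u\<close>,
  where \<open>W\<close> has covariance \<open>A - v v\<^sup>T\<close>; the left-hand side conditions on \<open>W + u v\<close>.\<close>

lemma nn_integral_gauss_downdate: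
  fixes A :: "real^'m^'m" and G :: "real^'m \<Rightarrow> real \<Rightarrow> ennreal"
  assumes A: "positive_definite A" and B: "positive_definite (A - outer_square v)"
    and G [measurable]: "case_prod G \<in> borel_measurable (borel \<Otimes>\<^sub>M borel)"
  shows "(\<integral>\<^sup>+z. gauss_density A z * (\<integral>\<^sup>+u. G z u *
       normal_density (v \<bullet> (matrix_inv A *v z)) (sqrt (1 - v \<bullet> (matrix_inv A *v v))) u \<partial>lborel) \<partial>lborel) =
    (\<integral>\<^sup>+u. std_normal_density u * (\<integral>\<^sup>+w. G (w + u *\<^sub>R v) u * gauss_density (A - outer_square v) w \<partial>lborel) \<partial>lborel)"
    (is "?l = ?r")
proof -
  let ?B = "A - outer_square v"
  have "?l = (\<integral>\<^sup>+z. (\<integral>\<^sup>+u. G z u * (gauss_density ?B (z - u *\<^sub>R v) * std_normal_density u) \<partial>lborel) \<partial>lborel)"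
    unfolding gauss_density_downdate[OF A B]
    by (intro nn_integral_cong, subst nn_integral_cmult[symmetric])
      (auto simp: ennreal_mult' gauss_density_nonneg[OF A] mult_ac intro!: nn_integral_cong)
  also have "\<dots> = (\<integral>\<^sup>+u. (\<integral>\<^sup>+z. G z u * (gauss_density ?B (z - u *\<^sub>R v) * std_normal_density u) \<partial>lborel) \<partial>lborel)"
    by (rule lborel_pair.Fubini'[symmetric]) simp
  also have "\<dots> = ?r"
  proof (rule nn_integral_cong)
    fix u
    have "(\<integral>\<^sup>+z. G z u * (gauss_density ?B (z - u *\<^sub>R v) * std_normal_density u) \<partial>lborel) =
       std_normal_density u * (\<integral>\<^sup>+z. G z u * gauss_density ?B (z - u *\<^sub>R v) \<partial>lborel)"
      by (subst nn_integral_cmult[symmetric])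
        (auto simp: ennreal_mult' gauss_density_nonneg[OF B] mult_ac intro!: nn_integral_cong)
    also have "(\<integral>\<^sup>+z. G z u * gauss_density ?B (z - u *\<^sub>R v) \<partial>lborel) =
      (\<integral>\<^sup>+w. G (w + u *\<^sub>R v) u * gauss_density ?B w \<partial>lborel)"
      using nn_integral_lborel_translate[of "\<lambda>z. G z u * gauss_density ?B (z - u *\<^sub>R v)" "u *\<^sub>R v"]
      by simp
    finally show "(\<integral>\<^sup>+z. G z u * (gauss_density ?B (z - u *\<^sub>R v) * std_normal_density u) \<partial>lborel) =
      std_normal_density u * (\<integral>\<^sup>+w. G (w + u *\<^sub>R v) u * gauss_density ?B w \<partial>lborel)" .
  qed
  finally show ?thesis .
qed

section \<open>Supermodular functions and one covariance\<close>

lemma nn_integral_gaussian: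
  assumes S: "positive_definite S" and [measurable]: "F \<in> borel_measurable borel"
  shows "(\<integral>\<^sup>+z. F z \<partial>gaussian S) = (\<integral>\<^sup>+z. F z * gauss_density S z \<partial>lborel)"
  unfolding gaussian_def by (subst nn_integral_density) (auto simp: mult.commute)

lemma prob_space_std_normal: "prob_space std_normal_distribution"
  by (rule prob_space_normal_density) simp

text \<open>In the disintegration a function of z alone lets the conditional law of u integrate to
  1, so no convolution has to be computed.\<close>

lemma nn_integral_gaussian_add_outer_square:
  fixes B :: "real^'m^'m"
  assumes B: "positive_definite B" and F [measurable]: "F \<in> borel_measurable borel"
  shows "(\<integral>\<^sup>+z. F z \<partial>gaussian (B + outer_square v)) =
    (\<integral>\<^sup>+w. \<integral>\<^sup>+u. F (w + u *\<^sub>R v) \<partial>std_normal_distribution \<partial>gaussian B)"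
proof -
  let ?A = "B + outer_square v"
  let ?s = "sqrt (1 - v \<bullet> (matrix_inv ?A *v v))"
  have A: "positive_definite ?A" by (rule positive_definite_add_outer_square[OF B])
  have B': "positive_definite (?A - outer_square v)" using B by simp
  have "v \<bullet> (matrix_inv ?A *v v) < 1"
    using A B' sn_admissible_iff_positive_definite sn_admissible_def by blast
  then have s: "?s > 0" by simp
  interpret N: prob_space std_normal_distribution by (rule prob_space_std_normal)
  interpret G: prob_space "gaussian B" by (rule prob_space_gaussian[OF B])
  interpret P: pair_prob_space std_normal_distribution "gaussian B" ..
  have norm1: "(\<integral>\<^sup>+u. normal_density m ?s u \<partial>lborel) = 1" for m
    using s by (simp add: nn_integral_eq_integral del: real_sqrt_gt_0_iff)
  have "(\<integral>\<^sup>+z. F z \<partial>gaussian ?A) = (\<integral>\<^sup>+z. gauss_density ?A z * (\<integral>\<^sup>+u. F z *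
      normal_density (v \<bullet> (matrix_inv ?A *v z)) ?s u \<partial>lborel) \<partial>lborel)"
    by (simp add: nn_integral_gaussian[OF A] nn_integral_cmult norm1 mult.commute)
  also have "\<dots> = (\<integral>\<^sup>+u. std_normal_density u * (\<integral>\<^sup>+w. F (w + u *\<^sub>R v) * gauss_density B w \<partial>lborel) \<partial>lborel)"
    using nn_integral_gauss_downdate[OF A B', of "\<lambda>z u. F z"] by simp
  also have "\<dots> = (\<integral>\<^sup>+u. \<integral>\<^sup>+w. F (w + u *\<^sub>R v) \<partial>gaussian B \<partial>std_normal_distribution)"
    by (simp add: nn_integral_gaussian[OF B] nn_integral_density)
  also have "\<dots> = (\<integral>\<^sup>+w. \<integral>\<^sup>+u. F (w + u *\<^sub>R v) \<partial>std_normal_distribution \<partial>gaussian B)"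
    by (rule P.Fubini'[symmetric]) simp
  finally show ?thesis .
qed

text \<open>Written as an image of one fixed product space, so that different choices of v and v'
  are coupled through the same w, u, u' and can be compared pointwise.\<close>

lemma gaussian_add_two_outer_squares:
  fixes B :: "real^'m^'m"
  assumes B: "positive_definite B"
  shows "gaussian (B + outer_square v + outer_square v') =
    distr (gaussian B \<Otimes>\<^sub>M (std_normal_distribution \<Otimes>\<^sub>M std_normal_distribution)) borel
      (\<lambda>(w, u, u'). w + u *\<^sub>R v + u' *\<^sub>R v')" (is "?N = distr ?M borel ?f")
proof (rule measure_eqI)
  fix X assume "X \<in> sets ?N"
  then have [measurable]: "X \<in> sets borel" by simp
  interpret N: prob_space std_normal_distribution by (rule prob_space_std_normal)
  interpret G: prob_space "gaussian B" by (rule prob_space_gaussian[OF B])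
  interpret NN: pair_prob_space std_normal_distribution std_normal_distribution ..
  have "emeasure ?N X = (\<integral>\<^sup>+z. indicator X z \<partial>?N)" by simp
  also have "\<dots> = (\<integral>\<^sup>+w. \<integral>\<^sup>+u. \<integral>\<^sup>+u'. indicator X (w + u *\<^sub>R v + u' *\<^sub>R v')
      \<partial>std_normal_distribution \<partial>std_normal_distribution \<partial>gaussian B)"
    by (subst nn_integral_gaussian_add_outer_square[OF positive_definite_add_outer_square[OF B]], simp)
      (rule nn_integral_gaussian_add_outer_square[OF B], measurable)
  also have "\<dots> = (\<integral>\<^sup>+w. (\<integral>\<^sup>+p. indicator X (?f (w, p)) \<partial>(std_normal_distribution \<Otimes>\<^sub>M std_normal_distribution)) \<partial>gaussian B)"
    by (intro nn_integral_cong, subst N.nn_integral_fst[symmetric]) auto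
  also have "\<dots> = (\<integral>\<^sup>+x. indicator X (?f x) \<partial>?M)"
    by (rule NN.nn_integral_fst) measurable
  also have "\<dots> = (\<integral>\<^sup>+z. indicator X z \<partial>distr ?M borel ?f)"
    by (subst nn_integral_distr) auto
  also have "\<dots> = emeasure (distr ?M borel ?f) X" by simp
  finally show "emeasure ?N X = emeasure (distr ?M borel ?f) X" .
qed simp

definition supermodular_vec :: "(real^'m \<Rightarrow> real) \<Rightarrow> bool" where
  "supermodular_vec F \<longleftrightarrow> (\<forall>x i j \<epsilon> \<eta>. i \<noteq> j \<longrightarrow> 0 \<le> \<epsilon> \<longrightarrow> 0 \<le> \<eta> \<longrightarrow>
     F (x + \<epsilon> *\<^sub>R axis i 1) + F (x + \<eta> *\<^sub>R axis j 1) \<le>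
     F (x + \<epsilon> *\<^sub>R axis i 1 + \<eta> *\<^sub>R axis j 1) + F x)"

lemma supermodular_vecD:
  "supermodular_vec F \<Longrightarrow> i \<noteq> j \<Longrightarrow> 0 \<le> \<epsilon> \<Longrightarrow> 0 \<le> \<eta> \<Longrightarrow>
     F (x + \<epsilon> *\<^sub>R axis i 1) + F (x + \<eta> *\<^sub>R axis j 1) \<le>
     F (x + \<epsilon> *\<^sub>R axis i 1 + \<eta> *\<^sub>R axis j 1) + F x"
  by (simp add: supermodular_vec_def)

text \<open>By symmetry c \<le> d; the inequality then concerns the square with lower corner (c, c)
  and side d - c in the coordinates i and j.\<close>

lemma supermodular_vec_swap:
  assumes F: "supermodular_vec F" and ij: "i \<noteq> j"
  shows "F (w + c *\<^sub>R axis i 1 + d *\<^sub>R axis j 1) + F (w + d *\<^sub>R axis i 1 + c *\<^sub>R axis j 1) \<le>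
    F (w + c *\<^sub>R axis i 1 + c *\<^sub>R axis j 1) + F (w + d *\<^sub>R axis i 1 + d *\<^sub>R axis j 1)"
proof (induction c d rule: linorder_wlog)
  case (le c d)
  show ?case
    using supermodular_vecD[OF F ij, of "d - c" "d - c" "w + c *\<^sub>R axis i 1 + c *\<^sub>R axis j 1"] le
    by (simp add: algebra_simps)
qed (simp add: add.commute)

text \<open>S arises by adding u and u' to different coordinates, in either assignment; T arises by
  adding one of them, u or u', to both. Hence the two sides of the swap inequality integrate to
  twice the two expectations.\<close>

lemma supermodular_gaussian_pair_step:
  fixes B :: "real^'m^'m" and a :: real
  assumes B: "positive_definite B" and F: "supermodular_vec F" and ij: "i \<noteq> j"
    and [measurable]: "F \<in> borel_measurable borel"
  defines "S \<equiv> B + outer_square (a *\<^sub>R axis i 1) + outer_square (a *\<^sub>R axis j 1)"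
    and "T \<equiv> B + outer_square (a *\<^sub>R (axis i 1 + axis j 1))"
  assumes "integrable (gaussian S) F" and "integrable (gaussian T) F"
  shows "(\<integral>z. F z \<partial>gaussian S) \<le> (\<integral>z. F z \<partial>gaussian T)"
proof -
  let ?M = "gaussian B \<Otimes>\<^sub>M (std_normal_distribution \<Otimes>\<^sub>M std_normal_distribution)"
  let ?i = "a *\<^sub>R axis i 1 :: real^'m" and ?j = "a *\<^sub>R axis j 1 :: real^'m"
  define f where "f v v' = (\<lambda>(w, u, u'). F (w + u *\<^sub>R v + u' *\<^sub>R v'))" for v v' :: "real^'m"
  have [simp]: "outer_square 0 = (0 :: real^'m^'m)" by (simp add: outer_square_def vec_eq_iff)
  have law: "integrable ?M (f v v')" "(\<integral>x. f v v' x \<partial>?M) = (\<integral>z. F z \<partial>gaussian C)"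
    if "integrable (gaussian C) F" "C = B + outer_square v + outer_square v'" for C v v'
    using that(1) unfolding that(2) f_def gaussian_add_two_outer_squares[OF B]
    by (simp_all add: integrable_distr_eq integral_distr split_beta')
  have S: "S = B + outer_square ?i + outer_square ?j" "S = B + outer_square ?j + outer_square ?i"
    by (simp_all add: S_def)
  \<comment> \<open>The zero vector as second direction brings T into the same two-summand form,
    with the common normal in either slot.\<close>
  have T: "T = B + outer_square (?i + ?j) + outer_square 0" "T = B + outer_square 0 + outer_square (?i + ?j)"
    by (simp_all add: T_def scaleR_add_right)
  note law = law[OF assms(7) S(1)] law[OF assms(7) S(2)] law[OF assms(8) T(1)] law[OF assms(8) T(2)]
  have "(\<integral>x. f ?i ?j x + f ?j ?i x \<partial>?M) \<le> (\<integral>x. f (?i + ?j) 0 x + f 0 (?i + ?j) x \<partial>?M)"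
  proof (intro integral_mono Bochner_Integration.integrable_add law)
    fix x :: "(real^'m) \<times> real \<times> real"
    obtain w u u' where x: "x = (w, u, u')" by (cases x)
    show "f ?i ?j x + f ?j ?i x \<le> f (?i + ?j) 0 x + f 0 (?i + ?j) x"
      using supermodular_vec_swap[OF F ij, of w "u * a" "u' * a"]
      by (simp add: f_def x algebra_simps)
  qed
  then show ?thesis
    by (simp add: law Bochner_Integration.integral_add)
qed

section \<open>From one covariance entry to the whole segment\<close>

definition pair_matrix :: "'m \<Rightarrow> 'm \<Rightarrow> real^'m^'m" where
  "pair_matrix i j = (\<chi> a b. of_bool (a = i \<and> b = j) + of_bool (a = j \<and> b = i))"

text \<open>For i different from j the cross terms are the only change: the entries (i, j) and (j,
  i) grow by a^2 and the variances stay.\<close>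

lemma outer_square_pair:
  "outer_square (a *\<^sub>R (axis i 1 + axis j 1)) =
    outer_square (a *\<^sub>R axis i 1) + outer_square (a *\<^sub>R axis j 1) + a\<^sup>2 *\<^sub>R pair_matrix i j"
  by (auto simp: outer_square_def pair_matrix_def vec_eq_iff axis_def power2_eq_square)

lemma transpose_pair_matrix [simp]: "transpose (pair_matrix i j) = pair_matrix i j"
  by (auto simp: transpose_def pair_matrix_def vec_eq_iff add.commute conj_commute)

lemma pair_matrix_form: "x \<bullet> (pair_matrix i j *v x) = 2 * (x $ i * x $ j)"
proof -
  have "(pair_matrix i j *v x) $ a = of_bool (a = i) * x $ j + of_bool (a = j) * x $ i" for a
  proof -
    have "(pair_matrix i j *v x) $ a = (\<Sum>b\<in>UNIV. (if b = j then of_bool (a = i) * x $ b else 0)) +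
       (\<Sum>b\<in>UNIV. (if b = i then of_bool (a = j) * x $ b else 0))"
      unfolding matrix_vector_mult_def pair_matrix_def vec_lambda_beta sum.distrib[symmetric]
      by (rule sum.cong) auto
    then show ?thesis by simp
  qed
  then have "x \<bullet> (pair_matrix i j *v x) = (\<Sum>a\<in>UNIV. (if a = i then x $ a * x $ j else 0)) +
       (\<Sum>a\<in>UNIV. (if a = j then x $ a * x $ i else 0))"
    unfolding inner_vec_def sum.distrib[symmetric]
    by (intro sum.cong) auto
  then show ?thesis by simp
qed

lemma matrix_form_scaleR_left: "x \<bullet> ((r *\<^sub>R A) *v x) = r * (x \<bullet> ((A::real^'m^'m) *v x))"
  by (simp add: scaleR_matrix_vector_assoc[symmetric])

lemma two_components_le_norm_square:
  fixes x :: "real^'m"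
  assumes "i \<noteq> j"
  shows "(x $ i)\<^sup>2 + (x $ j)\<^sup>2 \<le> (norm x)\<^sup>2"
proof -
  have "(norm x)\<^sup>2 = (\<Sum>k\<in>UNIV. (x $ k)\<^sup>2)"
    unfolding power2_norm_eq_inner inner_vec_def by (simp add: power2_eq_square)
  moreover have "(\<Sum>k\<in>{i, j}. (x $ k)\<^sup>2) \<le> (\<Sum>k\<in>UNIV. (x $ k)\<^sup>2)"
    by (intro sum_mono2) auto
  ultimately show ?thesis using assms by simp
qed

text \<open>Positive definiteness with a margin: \<epsilon> is a lower bound for the eigenvalues,
  and elementary steps use it up as a budget.\<close>

definition form_ge :: "real \<Rightarrow> real^'m^'m \<Rightarrow> bool" where
  "form_ge \<epsilon> A \<longleftrightarrow> transpose A = A \<and> (\<forall>x. \<epsilon> * (norm x)\<^sup>2 \<le> x \<bullet> (A *v x))"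

lemma outer_square_form: "x \<bullet> (outer_square v *v x) = (v \<bullet> x)\<^sup>2"
  by (simp add: outer_square_vector inner_commute power2_eq_square)

lemma form_ge_positive_definite: "form_ge \<epsilon> A \<Longrightarrow> \<epsilon> > 0 \<Longrightarrow> positive_definite A"
  unfolding form_ge_def positive_definite_def
  by (meson mult_pos_pos norm_eq_zero order_less_le_trans zero_less_power2)

text \<open>Both the removal of the two variances r from S and the addition of the covariance r cost
  at most r |x|^2 in the form, because the squares of two coordinates sum to at most |x|^2. So r <
  \<epsilon> keeps the common part B and the new covariance positive definite.\<close>

lemma supermodular_gaussian_step:
  fixes S :: "real^'m^'m"
  assumes S: "form_ge \<epsilon> S" and r: "0 \<le> r" "r < \<epsilon>" and ij: "i \<noteq> j"
    and F: "supermodular_vec F" "F \<in> borel_measurable borel"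
    and int: "\<And>C. positive_definite C \<Longrightarrow> integrable (gaussian C) F"
  shows "form_ge (\<epsilon> - r) (S + r *\<^sub>R pair_matrix i j)"
    and "(\<integral>z. F z \<partial>gaussian S) \<le> (\<integral>z. F z \<partial>gaussian (S + r *\<^sub>R pair_matrix i j))"
proof -
  let ?T = "S + r *\<^sub>R pair_matrix i j"
  have "(\<epsilon> - r) * (norm x)\<^sup>2 \<le> x \<bullet> (?T *v x)" for x
  proof -
    have "r * (2 * (x $ i * x $ j)) \<ge> r * (- (norm x)\<^sup>2)"
      using two_components_le_norm_square[OF ij, of x] zero_le_power2[of "x $ i + x $ j"] r(1)
      by (intro mult_left_mono) (auto simp: power2_eq_square algebra_simps)
    then show ?thesis
      using S by (simp add: form_ge_def matrix_vector_mult_add_rdistrib inner_add_right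
          matrix_form_scaleR_left pair_matrix_form algebra_simps) (smt (verit))
  qed
  moreover have "transpose ?T = ?T"
    using S by (simp add: form_ge_def transpose_add transpose_scalar)
  ultimately show T: "form_ge (\<epsilon> - r) ?T" by (simp add: form_ge_def)
  \<comment> \<open>The square root, since outer squares are quadratic in their vector.\<close>
  let ?i = "sqrt r *\<^sub>R axis i 1 :: real^'m" and ?j = "sqrt r *\<^sub>R axis j 1 :: real^'m"
  define B where "B = S - outer_square ?i - outer_square ?j"
  have "(\<epsilon> - r) * (norm x)\<^sup>2 \<le> x \<bullet> (B *v x)" for x
  proof -
    have "x \<bullet> (B *v x) = x \<bullet> (S *v x) - r * ((x $ i)\<^sup>2 + (x $ j)\<^sup>2)"
      using r by (simp add: B_def matrix_vector_mult_diff_rdistrib inner_diff_right outer_square_form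
          inner_axis' power_mult_distrib distrib_left)
    moreover have "r * ((x $ i)\<^sup>2 + (x $ j)\<^sup>2) \<le> r * (norm x)\<^sup>2"
      using two_components_le_norm_square[OF ij, of x] r(1) by (intro mult_left_mono) auto
    moreover have "\<epsilon> * (norm x)\<^sup>2 \<le> x \<bullet> (S *v x)" using S by (simp add: form_ge_def)
    ultimately show ?thesis by (simp add: algebra_simps)
  qed
  moreover have "transpose B = B"
    using S by (simp add: B_def form_ge_def transpose_diff transpose_outer_square)
  ultimately have B: "positive_definite B"
    using r by (intro form_ge_positive_definite[of "\<epsilon> - r"]) (auto simp: form_ge_def)
  have S': "S = B + outer_square ?i + outer_square ?j" by (simp add: B_def)
  have T': "?T = B + outer_square (sqrt r *\<^sub>R (axis i 1 + axis j 1))"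
    unfolding outer_square_pair using r by (simp add: B_def)
  have pd: "positive_definite S" "positive_definite ?T"
    using form_ge_positive_definite S T r by (auto intro: form_ge_positive_definite)
  show "(\<integral>z. F z \<partial>gaussian S) \<le> (\<integral>z. F z \<partial>gaussian ?T)"
    using supermodular_gaussian_pair_step[OF B F(1) ij F(2), of "sqrt r"]
    unfolding S'[symmetric] T'[symmetric] by (simp add: int pd)
qed

text \<open>Each step lowers the margin by its own increment; one pass over all entries is possible
  as long as the sum of the increments stays below \<epsilon>.\<close>

lemma supermodular_gaussian_steps:
  fixes S :: "real^'m^'m"
  assumes "finite K" and "form_ge \<epsilon> S" and "\<And>k. k \<in> K \<Longrightarrow> 0 \<le> r k" and "(\<Sum>k\<in>K. r k) < \<epsilon>"
    and "\<And>k. k \<in> K \<Longrightarrow> fst k \<noteq> snd k"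
    and F: "supermodular_vec F" "F \<in> borel_measurable borel"
    and int: "\<And>C. positive_definite C \<Longrightarrow> integrable (gaussian C) F"
  shows "form_ge (\<epsilon> - (\<Sum>k\<in>K. r k)) (S + (\<Sum>k\<in>K. r k *\<^sub>R pair_matrix (fst k) (snd k))) \<and>
    (\<integral>z. F z \<partial>gaussian S) \<le> (\<integral>z. F z \<partial>gaussian (S + (\<Sum>k\<in>K. r k *\<^sub>R pair_matrix (fst k) (snd k))))"
  using assms(1-5)
proof (induction K rule: finite_induct)
  case (insert k K)
  let ?T = "S + (\<Sum>k\<in>K. r k *\<^sub>R pair_matrix (fst k) (snd k))"
  have sum: "(\<Sum>k\<in>insert k K. r k) = r k + (\<Sum>k\<in>K. r k)"
    "S + (\<Sum>k\<in>insert k K. r k *\<^sub>R pair_matrix (fst k) (snd k)) = ?T + r k *\<^sub>R pair_matrix (fst k) (snd k)"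
    using insert.hyps by (simp_all add: algebra_simps)
  have rk: "0 \<le> r k" "r k < \<epsilon> - (\<Sum>k\<in>K. r k)" "fst k \<noteq> snd k"
    using insert.prems(2)[of k] insert.prems(3,4) unfolding sum by auto
  then have "(\<Sum>k\<in>K. r k) < \<epsilon>" by simp
  then have IH: "form_ge (\<epsilon> - (\<Sum>k\<in>K. r k)) ?T" "(\<integral>z. F z \<partial>gaussian S) \<le> (\<integral>z. F z \<partial>gaussian ?T)"
    using insert.IH insert.prems by auto
  show ?case
    unfolding sum using supermodular_gaussian_step[OF IH(1) rk F int] IH(2)
    by (auto simp: algebra_simps)
qed auto

text \<open>The half compensates for the sum over ordered pairs, in which every off-diagonal
  position is met twice.\<close>

lemma off_diagonal_sum_pair_matrix:
  fixes D :: "real^'m^'m"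
  assumes "transpose D = D" and "\<And>i. D $ i $ i = 0"
  shows "D = (\<Sum>k\<in>{k. fst k \<noteq> snd k}. (D $ fst k $ snd k / 2) *\<^sub>R pair_matrix (fst k) (snd k))"
proof -
  have sym: "D $ a $ b = D $ b $ a" for a b
    using assms(1) by (metis transpose_def vec_lambda_beta)
  have "(\<Sum>k\<in>{k. fst k \<noteq> snd k}. (D $ fst k $ snd k / 2) *\<^sub>R pair_matrix (fst k) (snd k)) $ a $ b = D $ a $ b"
    for a b
  proof -
    have "(\<Sum>k\<in>{k. fst k \<noteq> snd k}. (D $ fst k $ snd k / 2) *\<^sub>R pair_matrix (fst k) (snd k)) $ a $ b =
      (\<Sum>k\<in>{k. fst k \<noteq> snd k}. (if (a, b) = k then D $ fst k $ snd k / 2 else 0)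
        + (if (b, a) = k then D $ fst k $ snd k / 2 else 0))"
      by (auto simp: pair_matrix_def intro!: sum.cong)
    also have "\<dots> = D $ a $ b"
      unfolding sum.distrib using assms(2) sym[of a b] by (auto simp: sum.delta)
    finally show ?thesis .
  qed
  then show ?thesis by (simp add: vec_eq_iff)
qed

text \<open>A common eigenvalue bound \<epsilon> of S and T holds, by convexity, on the whole
  segment. Each of N equal pieces is one pass of elementary steps that starts with the full margin
  \<epsilon> again, whatever earlier passes used up.\<close>

lemma supermodular_gaussian_all_integrable:
  fixes S T :: "real^'m^'m"
  assumes S: "positive_definite S" and T: "positive_definite T"
    and diag: "\<And>i. S $ i $ i = T $ i $ i" and le: "\<And>i j. S $ i $ j \<le> T $ i $ j"
    and F: "supermodular_vec F" "F \<in> borel_measurable borel"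
    and int: "\<And>C. positive_definite C \<Longrightarrow> integrable (gaussian C) F"
  shows "(\<integral>z. F z \<partial>gaussian S) \<le> (\<integral>z. F z \<partial>gaussian T)"
proof -
  define D where "D = T - S"
  obtain c where c: "c > 0" "\<And>x. c * (norm x)\<^sup>2 \<le> x \<bullet> (S *v x)"
    using positive_definite_lower_bound[OF S] by metis
  obtain d where d: "d > 0" "\<And>x. d * (norm x)\<^sup>2 \<le> x \<bullet> (T *v x)"
    using positive_definite_lower_bound[OF T] by metis
  define \<epsilon> where "\<epsilon> = min c d"
  have \<epsilon>: "\<epsilon> > 0" using c d by (simp add: \<epsilon>_def)
  have Sx: "\<epsilon> * (norm x)\<^sup>2 \<le> x \<bullet> (S *v x)" for x
    by (rule order_trans[OF _ c(2)]) (simp add: \<epsilon>_def mult_right_mono)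
  have Tx: "\<epsilon> * (norm x)\<^sup>2 \<le> x \<bullet> (T *v x)" for x
    by (rule order_trans[OF _ d(2)]) (simp add: \<epsilon>_def mult_right_mono)
  have trS: "transpose S = S" and trD: "transpose D = D"
    using S T by (simp_all add: D_def positive_definite_def transpose_diff)
  let ?K = "{k :: 'm \<times> 'm. fst k \<noteq> snd k}"
  let ?s = "\<Sum>k\<in>?K. D $ fst k $ snd k / 2"
  \<comment> \<open>\<open>?s\<close> is the total of all elementary increments from S to T; N is
    chosen so that the share of one piece fits into \<epsilon>.\<close>
  obtain N :: nat where N: "?s / \<epsilon> < real N" using reals_Archimedean2 by blast
  have s0: "0 \<le> ?s" by (intro sum_nonneg) (simp add: D_def le)
  then have "0 < real N" using N \<epsilon> by (smt (verit) divide_nonneg_pos)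
  then have N0: "N > 0" by simp
  have sN: "?s / N < \<epsilon>" using N \<epsilon> N0 by (simp add: field_simps)
  define P where "P k = S + (real k / N) *\<^sub>R D" for k
  have P: "form_ge \<epsilon> (P k)" if "k \<le> N" for k
  proof -
    define t where "t = real k / N"
    have t: "0 \<le> t" "t \<le> 1" using that N0 by (auto simp: t_def)
    have e: "x \<bullet> (P k *v x) = (1 - t) * (x \<bullet> (S *v x)) + t * (x \<bullet> (T *v x))" for x
      unfolding P_def t_def[symmetric] D_def
      by (simp add: matrix_vector_mult_add_rdistrib inner_add_right matrix_form_scaleR_left
          matrix_vector_mult_diff_rdistrib inner_diff_right algebra_simps)
    have l: "(1 - t) * (\<epsilon> * (norm x)\<^sup>2) + t * (\<epsilon> * (norm x)\<^sup>2) \<le>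
        (1 - t) * (x \<bullet> (S *v x)) + t * (x \<bullet> (T *v x))" for x
      using t Sx Tx by (intro add_mono mult_left_mono) auto
    have "(1 - t) * y + t * y = y" for y by (simp add: algebra_simps)
    then have "\<epsilon> * (norm x)\<^sup>2 \<le> x \<bullet> (P k *v x)" for x
      using l[of x] unfolding e by simp
    then show ?thesis
      using trS trD by (simp add: form_ge_def P_def transpose_add transpose_scalar)
  qed
  have step: "(\<integral>z. F z \<partial>gaussian (P k)) \<le> (\<integral>z. F z \<partial>gaussian (P (Suc k)))" if "k < N" for k
  proof -
    let ?r = "\<lambda>k. D $ fst k $ snd k / 2 / N"
    have "P (Suc k) = P k + (1 / N) *\<^sub>R D"
      using N0 by (simp add: P_def scaleR_add_left[symmetric] add_divide_distrib)
    also have "(1 / N) *\<^sub>R D = (\<Sum>k\<in>?K. ?r k *\<^sub>R pair_matrix (fst k) (snd k))"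
    proof -
      have "D = (\<Sum>k\<in>?K. (D $ fst k $ snd k / 2) *\<^sub>R pair_matrix (fst k) (snd k))"
        by (rule off_diagonal_sum_pair_matrix[OF trD]) (simp add: D_def diag)
      then have "(1 / N) *\<^sub>R D = (1 / N) *\<^sub>R (\<Sum>k\<in>?K. (D $ fst k $ snd k / 2) *\<^sub>R pair_matrix (fst k) (snd k))"
        by (rule arg_cong)
      then show ?thesis by (simp only: scaleR_sum_right scaleR_scaleR) (simp add: mult.commute)
    qed
    finally have PS: "P (Suc k) = P k + (\<Sum>k\<in>?K. ?r k *\<^sub>R pair_matrix (fst k) (snd k))" .
    have "(\<Sum>k\<in>?K. ?r k) < \<epsilon>" using sN by (simp add: sum_divide_distrib)
    moreover have "0 \<le> ?r k" for k using le[of "fst k" "snd k"] by (simp add: D_def)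
    ultimately show ?thesis
      unfolding PS
      by (intro conjunct2[OF supermodular_gaussian_steps[of ?K \<epsilon> "P k" ?r F]])
        (use P[of k] that F int in auto)
  qed
  have "(\<integral>z. F z \<partial>gaussian (P 0)) \<le> (\<integral>z. F z \<partial>gaussian (P k))" if "k \<le> N" for k
    using that by (induction k) (auto intro: order_trans[OF _ step])
  from this[of N] show ?thesis using N0 by (simp add: P_def D_def)
qed

section \<open>Coordinatewise stretching\<close>

lemma nn_integral_substitution_Ioo:
  fixes h h' :: "real \<Rightarrow> real"
  assumes der: "\<And>x. (h has_real_derivative h' x) (at x)" and nonneg: "\<And>x. 0 \<le> h' x"
    and [measurable]: "h' \<in> borel_measurable borel"
    and mono: "strict_mono h" and surj: "surj h" and lu: "l \<le> u"
  shows "(\<integral>\<^sup>+y. ennreal (h' y) * indicator {l<..<u} (h y) \<partial>lborel) = ennreal (u - l)"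
proof -
  obtain a b where ab: "l = h a" "u = h b" using surj by (metis surjD)
  have le: "a \<le> b" using lu mono by (simp add: ab strict_mono_less_eq)
  have "(\<integral>\<^sup>+y. ennreal (h' y) * indicator {l<..<u} (h y) \<partial>lborel) =
      (\<integral>\<^sup>+y. ennreal (h' y) * indicator {a..b} y \<partial>lborel)"
  proof (rule nn_integral_cong_AE)
    show "AE y in lborel. ennreal (h' y) * indicator {l<..<u} (h y) = ennreal (h' y) * indicator {a..b} y"
      using AE_lborel_singleton[of a] AE_lborel_singleton[of b]
      by eventually_elim (auto simp: ab indicator_def strict_mono_less[OF mono])
  qed
  also have "\<dots> = ennreal (h b - h a)"
    by (rule nn_integral_FTC_Icc) (use der nonneg le in auto)
  finally show ?thesis by (simp add: ab)
qed

text \<open>Lebesgue measure is determined by the volumes of boxes, and on a box both the density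
  and the indicator factor over the coordinates. This leaves the fundamental theorem of calculus in
  one variable.\<close>

lemma lborel_coordinatewise_substitution:
  fixes h h' :: "real \<Rightarrow> real"
  assumes der: "\<And>x. (h has_real_derivative h' x) (at x)" and nonneg: "\<And>x. 0 \<le> h' x"
    and h' [measurable]: "h' \<in> borel_measurable borel"
    and mono: "strict_mono h" and surj: "surj h"
  shows "(lborel :: 'a::euclidean_space measure) =
    distr (density lborel (\<lambda>y. \<Prod>b\<in>Basis. ennreal (h' (y \<bullet> b)))) borel (\<lambda>y. \<Sum>b\<in>Basis. h (y \<bullet> b) *\<^sub>R b)"
    (is "_ = distr ?D borel ?H")
proof (rule lborel_eqI)
  have "continuous_on UNIV h"
    using der by (meson DERIV_continuous continuous_at_imp_continuous_on)
  then have [measurable]: "h \<in> borel_measurable borel"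
    by (rule borel_measurable_continuous_onI)
  fix l u :: 'a assume lu: "\<And>b. b \<in> Basis \<Longrightarrow> l \<bullet> b \<le> u \<bullet> b"
  have [measurable]: "box l u \<in> sets borel" by simp
  have ind: "(\<Prod>b\<in>Basis. ennreal (h' (y \<bullet> b))) * indicator (box l u) (?H y) =
    (\<Prod>b\<in>Basis. ennreal (h' (y \<bullet> b)) * indicator {l \<bullet> b<..<u \<bullet> b} (h (y \<bullet> b)))" for y :: 'a
  proof -
    have "indicator (box l u) (?H y) = (\<Prod>b\<in>Basis. indicator {l \<bullet> b<..<u \<bullet> b} (h (y \<bullet> b)) :: ennreal)"
    proof (cases "?H y \<in> box l u")
      case True
      then show ?thesis by (simp add: mem_box)
    next
      case False
      then obtain b where "b \<in> Basis" "\<not> (l \<bullet> b < h (y \<bullet> b) \<and> h (y \<bullet> b) < u \<bullet> b)"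
        by (auto simp: mem_box)
      then have "(\<Prod>b\<in>Basis. indicator {l \<bullet> b<..<u \<bullet> b} (h (y \<bullet> b)) :: ennreal) = 0"
        by (intro prod_zero) (auto intro!: bexI[of _ b])
      with False show ?thesis by simp
    qed
    then show ?thesis by (simp add: prod.distrib)
  qed
  have "emeasure (distr ?D borel ?H) (box l u) = (\<integral>\<^sup>+x. indicator (box l u) x \<partial>distr ?D borel ?H)"
    by simp
  also have "\<dots> = (\<integral>\<^sup>+y. (\<Prod>b\<in>Basis. ennreal (h' (y \<bullet> b))) * indicator (box l u) (?H y) \<partial>lborel)"
    by (subst nn_integral_distr, simp, simp) (subst nn_integral_density, auto)
  also have "\<dots> = (\<Prod>b\<in>Basis. \<integral>\<^sup>+y. ennreal (h' y) * indicator {l \<bullet> b<..<u \<bullet> b} (h y) \<partial>lborel)"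
    unfolding ind by (rule nn_integral_lborel_prod) auto
  also have "\<dots> = (\<Prod>b\<in>Basis. ennreal ((u - l) \<bullet> b))"
    by (intro prod.cong refl) 
      (simp add: nn_integral_substitution_Ioo[OF der nonneg h' mono surj lu] inner_diff_left)
  also have "\<dots> = ennreal (\<Prod>b\<in>Basis. (u - l) \<bullet> b)"
    by (rule prod_ennreal) (simp add: lu inner_diff_left)
  finally show "emeasure (distr ?D borel ?H) (box l u) = ennreal (\<Prod>b\<in>Basis. (u - l) \<bullet> b)" .
qed simp

section \<open>The stretching map and its inverse\<close>

definition stretch :: "real \<Rightarrow> real \<Rightarrow> real" where
  "stretch \<kappa> y = y * (1 + \<kappa> * ln (1 + y\<^sup>2))"

definition stretch_deriv :: "real \<Rightarrow> real \<Rightarrow> real" where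
  "stretch_deriv \<kappa> y = 1 + \<kappa> * (ln (1 + y\<^sup>2) + 2 * y\<^sup>2 / (1 + y\<^sup>2))"

definition shrink :: "real \<Rightarrow> real \<Rightarrow> real" where
  "shrink \<kappa> = inv (stretch \<kappa>)"

lemma one_plus_square_pos: "0 < 1 + (y::real)\<^sup>2"
  by (simp add: add_pos_nonneg)

lemma stretch_has_derivative: "(stretch \<kappa> has_real_derivative stretch_deriv \<kappa> y) (at y)"
  unfolding stretch_def[abs_def] stretch_deriv_def
  using one_plus_square_pos[of y]
  by (auto intro!: derivative_eq_intros simp: field_simps power2_eq_square)

lemma stretch_deriv_ge_1: "\<kappa> \<ge> 0 \<Longrightarrow> stretch_deriv \<kappa> y \<ge> 1"
  by (simp add: stretch_deriv_def)

text \<open>The exponential form, from 1 + t \<le> exp t, turns the product over the coordinates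
  into a sum that a Gaussian exponent can absorb.\<close>

lemma stretch_deriv_le:
  assumes "\<kappa> \<ge> 0" "\<bar>y\<bar> \<le> N"
  shows "stretch_deriv \<kappa> y \<le> exp (\<kappa> * (ln (1 + N\<^sup>2) + 2))"
proof -
  have "y\<^sup>2 \<le> N\<^sup>2"
    using power_mono[OF assms(2), of 2] by simp
  then have "ln (1 + y\<^sup>2) \<le> ln (1 + N\<^sup>2)"
    using one_plus_square_pos by (subst ln_le_cancel_iff) auto
  moreover have "2 * y\<^sup>2 / (1 + y\<^sup>2) \<le> 2"
    using one_plus_square_pos[of y] by (simp add: field_simps)
  ultimately have "\<kappa> * (ln (1 + y\<^sup>2) + 2 * y\<^sup>2 / (1 + y\<^sup>2)) \<le> \<kappa> * (ln (1 + N\<^sup>2) + 2)"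
    using assms(1) by (intro mult_left_mono) auto
  then show ?thesis
    unfolding stretch_deriv_def using exp_ge_add_one_self[of "\<kappa> * (ln (1 + N\<^sup>2) + 2)"] by linarith
qed

lemma strict_mono_stretch:
  assumes "\<kappa> \<ge> 0"
  shows "strict_mono (stretch \<kappa>)"
proof (rule strict_monoI)
  fix x y :: real assume xy: "x < y"
  have "stretch_deriv \<kappa> z > 0" for z
    using stretch_deriv_ge_1[OF assms, of z] by linarith
  then have "\<exists>d. (stretch \<kappa> has_real_derivative d) (at z) \<and> d > 0" for z
    by (intro exI conjI) (rule stretch_has_derivative, simp)
  then show "stretch \<kappa> x < stretch \<kappa> y"
    by (rule DERIV_pos_imp_increasing[OF xy])
qed

lemma continuous_stretch: "continuous_on A (stretch \<kappa>)"
  using stretch_has_derivative by (meson DERIV_continuous continuous_at_imp_continuous_on)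

text \<open>Stretching never decreases the absolute value, so a preimage of x lies between 0 and
  x.\<close>

lemma surj_stretch:
  assumes "\<kappa> \<ge> 0"
  shows "surj (stretch \<kappa>)"
proof -
  have "\<exists>y. stretch \<kappa> y = x" for x
  proof (cases "x \<ge> 0")
    case True
    then have "stretch \<kappa> 0 \<le> x" "x \<le> stretch \<kappa> x"
      using assms by (simp_all add: stretch_def algebra_simps)
    then show ?thesis using IVT'[OF _ _ True continuous_stretch] by blast
  next
    case False
    then have "stretch \<kappa> x \<le> x" "x \<le> stretch \<kappa> 0"
      using assms by (simp_all add: stretch_def algebra_simps mult_nonneg_nonpos mult_nonpos_nonneg)
    then show ?thesis using IVT'[OF _ _ _ continuous_stretch, of \<kappa> x x 0] False by force
  qed
  then show ?thesis by (metis surjI)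
qed

lemma shrink_stretch: "\<kappa> \<ge> 0 \<Longrightarrow> shrink \<kappa> (stretch \<kappa> y) = y"
  by (simp add: shrink_def strict_mono_stretch strict_mono_imp_inj_on inv_f_f)

lemma mono_shrink:
  assumes "\<kappa> \<ge> 0"
  shows "mono (shrink \<kappa>)"
proof (rule monoI)
  fix x y :: real assume "x \<le> y"
  then show "shrink \<kappa> x \<le> shrink \<kappa> y"
    unfolding shrink_def using strict_mono_less_eq[OF strict_mono_stretch[OF assms]] surj_stretch[OF assms]
    by (metis surj_f_inv_f)
qed

definition stretch_vec :: "real \<Rightarrow> real^'m \<Rightarrow> real^'m" where
  "stretch_vec \<kappa> y = (\<chi> i. stretch \<kappa> (y $ i))"

definition shrink_vec :: "real \<Rightarrow> real^'m \<Rightarrow> real^'m" where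
  "shrink_vec \<kappa> x = (\<chi> i. shrink \<kappa> (x $ i))"

definition stretch_jacobian :: "real \<Rightarrow> real^'m \<Rightarrow> real" where
  "stretch_jacobian \<kappa> y = (\<Prod>i\<in>UNIV. stretch_deriv \<kappa> (y $ i))"

lemma shrink_vec_stretch_vec: "\<kappa> \<ge> 0 \<Longrightarrow> shrink_vec \<kappa> (stretch_vec \<kappa> y) = y"
  by (simp add: shrink_vec_def stretch_vec_def shrink_stretch vec_eq_iff)

lemma borel_measurable_stretch_deriv [measurable]: "stretch_deriv \<kappa> \<in> borel_measurable borel"
  unfolding stretch_deriv_def[abs_def] by measurable

lemma borel_measurable_stretch [measurable]: "stretch \<kappa> \<in> borel_measurable borel"
  unfolding stretch_def[abs_def] by measurable

lemma borel_measurable_vec_component [measurable]: "(\<lambda>x :: real^'m. x $ i) \<in> borel_measurable borel"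
  by (intro borel_measurable_continuous_onI continuous_intros)

lemma borel_measurable_vec_lambda:
  fixes f :: "'a \<Rightarrow> 'm::finite \<Rightarrow> real"
  assumes "\<And>i. (\<lambda>x. f x i) \<in> borel_measurable M"
  shows "(\<lambda>x. (\<chi> i. f x i) :: real^'m) \<in> borel_measurable M"
proof -
  have "(\<lambda>x. ((\<chi> i. f x i) :: real^'m) \<bullet> b) \<in> borel_measurable M" if "b \<in> Basis" for b
    using that assms by (auto simp: Basis_vec_def inner_axis)
  then show ?thesis by (subst borel_measurable_euclidean_space) blast
qed

lemma borel_measurable_stretch_jacobian [measurable]: "stretch_jacobian \<kappa> \<in> borel_measurable borel"
  unfolding stretch_jacobian_def[abs_def] by measurable

lemma borel_measurable_stretch_vec [measurable]: "stretch_vec \<kappa> \<in> borel_measurable borel"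
  unfolding stretch_vec_def[abs_def] by (rule borel_measurable_vec_lambda) measurable

lemma borel_measurable_shrink_vec:
  assumes "\<kappa> \<ge> 0"
  shows "shrink_vec \<kappa> \<in> borel_measurable borel"
proof -
  have [measurable]: "shrink \<kappa> \<in> borel_measurable borel"
    by (rule borel_measurable_mono[OF mono_shrink[OF assms]])
  show ?thesis
    unfolding shrink_vec_def[abs_def] by (rule borel_measurable_vec_lambda) measurable
qed

lemma stretch_jacobian_nonneg: "\<kappa> \<ge> 0 \<Longrightarrow> 0 \<le> stretch_jacobian \<kappa> y"
  unfolding stretch_jacobian_def by (intro prod_nonneg) (meson order_trans stretch_deriv_ge_1 zero_le_one)

lemma lborel_stretch:
  assumes "\<kappa> \<ge> 0"
  shows "(lborel :: (real^'m) measure) =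
    distr (density lborel (\<lambda>y. ennreal (stretch_jacobian \<kappa> y))) borel (stretch_vec \<kappa>)"
proof -
  have nonneg: "0 \<le> stretch_deriv \<kappa> y" for y
    using stretch_deriv_ge_1[OF assms] by (meson order_trans zero_le_one)
  have Basis: "(Basis :: (real^'m) set) = range (\<lambda>i. axis i 1)"
    by (auto simp: Basis_vec_def)
  have inj: "inj (\<lambda>i. axis i 1 :: real^'m)"
    by (auto simp: inj_on_def axis_eq_axis)
  have prod: "(\<Prod>b\<in>Basis. ennreal (stretch_deriv \<kappa> (y \<bullet> b))) = ennreal (stretch_jacobian \<kappa> y)" for y :: "real^'m"
    unfolding Basis stretch_jacobian_def by (subst prod.reindex[OF inj]) (simp add: inner_axis prod_ennreal nonneg)
  have sum: "(\<Sum>b\<in>Basis. stretch \<kappa> (y \<bullet> b) *\<^sub>R b) = stretch_vec \<kappa> y" for y :: "real^'m"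
    unfolding Basis stretch_vec_def
    by (subst sum.reindex[OF inj], simp add: inner_axis vec_eq_iff)
      (simp add: axis_def if_distrib cong: if_cong)
  show ?thesis
    using lborel_coordinatewise_substitution[OF stretch_has_derivative nonneg
      borel_measurable_stretch_deriv strict_mono_stretch[OF assms] surj_stretch[OF assms], where 'a="real^'m"]
    unfolding prod sum .
qed

text \<open>The substitution frees the argument of f from \<kappa>, so f stays a fixed measurable
  function and only its weight varies.\<close>

lemma integral_shrink:
  fixes f :: "real^'m \<Rightarrow> real" and g :: "real^'m \<Rightarrow> real"
  assumes \<kappa>: "\<kappa> \<ge> 0" and [measurable]: "f \<in> borel_measurable borel" "g \<in> borel_measurable borel"
  shows "integrable lborel (\<lambda>x. f (shrink_vec \<kappa> x) * g x) \<longleftrightarrow>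
      integrable lborel (\<lambda>y. f y * (g (stretch_vec \<kappa> y) * stretch_jacobian \<kappa> y))"
    and "(\<integral>x. f (shrink_vec \<kappa> x) * g x \<partial>lborel) =
      (\<integral>y. f y * (g (stretch_vec \<kappa> y) * stretch_jacobian \<kappa> y) \<partial>lborel)"
proof -
  note [measurable] = borel_measurable_shrink_vec[OF \<kappa>]
  let ?D = "density lborel (\<lambda>y :: real^'m. ennreal (stretch_jacobian \<kappa> y))"
  let ?f = "\<lambda>x. f (shrink_vec \<kappa> x) * g x"
  have "integrable lborel ?f \<longleftrightarrow> integrable (distr ?D borel (stretch_vec \<kappa>)) ?f"
    by (simp only: lborel_stretch[OF \<kappa>, symmetric])
  also have "\<dots> \<longleftrightarrow> integrable ?D (\<lambda>y. f y * g (stretch_vec \<kappa> y))"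
    by (subst integrable_distr_eq) (simp_all add: shrink_vec_stretch_vec[OF \<kappa>])
  also have "\<dots> \<longleftrightarrow> integrable lborel (\<lambda>y. f y * (g (stretch_vec \<kappa> y) * stretch_jacobian \<kappa> y))"
    by (subst integrable_density) (simp_all add: stretch_jacobian_nonneg[OF \<kappa>] mult_ac)
  finally show "integrable lborel ?f \<longleftrightarrow>
      integrable lborel (\<lambda>y. f y * (g (stretch_vec \<kappa> y) * stretch_jacobian \<kappa> y))" .
  have "(\<integral>x. ?f x \<partial>lborel) = (\<integral>x. ?f x \<partial>distr ?D borel (stretch_vec \<kappa>))"
    by (simp only: lborel_stretch[OF \<kappa>, symmetric])
  also have "\<dots> = (\<integral>y. f y * g (stretch_vec \<kappa> y) \<partial>?D)"
    by (subst integral_distr) (simp_all add: shrink_vec_stretch_vec[OF \<kappa>])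
  also have "\<dots> = (\<integral>y. f y * (g (stretch_vec \<kappa> y) * stretch_jacobian \<kappa> y) \<partial>lborel)"
    by (subst integral_density) (simp_all add: stretch_jacobian_nonneg[OF \<kappa>] mult_ac)
  finally show "(\<integral>x. ?f x \<partial>lborel) =
      (\<integral>y. f y * (g (stretch_vec \<kappa> y) * stretch_jacobian \<kappa> y) \<partial>lborel)" .
qed

section \<open>The Gaussian supermodular order\<close>

text \<open>Where c ln (1 + N^2) \<ge> D + m, the terms in N^2 have a nonpositive sum. Elsewhere 1 +
  N^2 is at most exp ((D + m) / c), which gives the constant. Here m stands for the Jacobian and D
  for every quadratic loss.\<close>

lemma log_square_dominates:
  assumes "c > 0" "D \<ge> 0" "m \<ge> 0"
  obtains K where "K \<ge> 0" "\<And>N::real. - (c * ln (1 + N\<^sup>2) * N\<^sup>2) + D * N\<^sup>2 + m * (ln (1 + N\<^sup>2) + 2) \<le> K"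
proof -
  let ?K = "2 * m + (D + m) * exp ((D + m) / c)"
  have "- (c * ln (1 + N\<^sup>2) * N\<^sup>2) + D * N\<^sup>2 + m * (ln (1 + N\<^sup>2) + 2) \<le> ?K" for N :: real
  proof -
    let ?L = "ln (1 + N\<^sup>2)"
    have L: "0 \<le> ?L" "?L \<le> N\<^sup>2" by (simp, rule ln_add_one_self_le_self) simp
    have "m * ?L \<le> m * N\<^sup>2" using L assms by (intro mult_left_mono) auto
    then have 1: "- (c * ?L * N\<^sup>2) + D * N\<^sup>2 + m * (?L + 2) \<le> (D + m - c * ?L) * N\<^sup>2 + 2 * m"
      by (simp add: algebra_simps)
    show ?thesis
    proof (cases "D + m \<le> c * ?L")
      case True
      then have "(D + m - c * ?L) * N\<^sup>2 \<le> 0" by (simp add: mult_nonpos_nonneg)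
      moreover have "0 \<le> (D + m) * exp ((D + m) / c)" using assms by simp
      ultimately show ?thesis using 1 by linarith
    next
      case False
      then have "?L \<le> (D + m) / c" using assms by (simp add: field_simps)
      then have "1 + N\<^sup>2 \<le> exp ((D + m) / c)"
        using one_plus_square_pos[of N] by (metis exp_le_cancel_iff exp_ln)
      then have "(D + m) * N\<^sup>2 \<le> (D + m) * exp ((D + m) / c)"
        using assms by (intro mult_left_mono) auto
      moreover have "(D + m - c * ?L) * N\<^sup>2 \<le> (D + m) * N\<^sup>2"
        using assms L by (intro mult_right_mono) auto
      ultimately show ?thesis using 1 by linarith
    qed
  qed
  moreover have "?K \<ge> 0" using assms by simp
  ultimately show ?thesis using that by blast
qed

text \<open>The stretching displaces \<open>y\<close> by \<open>\<kappa>\<close> times a vector that differs from \<open>ln (1 + |y|\<^sup>2) y\<close> by at most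
  a constant multiple of \<open>|y|\<close>, because \<open>a ln (r / a) \<le> r\<close>. So for large \<open>y\<close> it increases every
  positive definite form, whatever the correlations.\<close>

lemma stretch_form_ge:
  fixes A :: "real^'m^'m"
  assumes A: "positive_definite A"
  obtains c D where "c > 0" "D \<ge> 0"
    "\<And>\<kappa> y. \<kappa> \<ge> 0 \<Longrightarrow> y \<bullet> (A *v y) + 2 * \<kappa> * ((c * ln (1 + (norm y)\<^sup>2) - D) * (norm y)\<^sup>2) \<le>
      stretch_vec \<kappa> y \<bullet> (A *v stretch_vec \<kappa> y)"
proof -
  obtain c where c: "c > 0" "\<And>x. c * (norm x)\<^sup>2 \<le> x \<bullet> (A *v x)"
    using positive_definite_lower_bound[OF A] by metis
  obtain C where C: "C \<ge> 0" "\<And>x y. \<bar>x \<bullet> (A *v y)\<bar> \<le> C * norm x * norm y"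
    using matrix_form_bound by metis
  let ?m = "real CARD('m)"
  have main: "y \<bullet> (A *v y) + 2 * \<kappa> * ((c * ln (1 + (norm y)\<^sup>2) - C * (?m * 2)) * (norm y)\<^sup>2) \<le>
      stretch_vec \<kappa> y \<bullet> (A *v stretch_vec \<kappa> y)" if \<kappa>: "\<kappa> \<ge> 0" for \<kappa> and y :: "real^'m"
  proof -
    let ?L = "ln (1 + (norm y)\<^sup>2)"
    \<comment> \<open>The displacement per unit of \<kappa>; \<open>e\<close> below is its deviation
      from a multiple of y.\<close>
    define w where "w = (\<chi> i. y $ i * ln (1 + (y $ i)\<^sup>2))"
    define e where "e = ?L *\<^sub>R y - w"
    have comp: "\<bar>e $ i\<bar> \<le> 2 * norm y" for i
    proof (cases "y $ i = 0")
      case False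
      let ?a = "\<bar>y $ i\<bar>" and ?r = "norm y"
      have a: "0 < ?a" "?a \<le> ?r" using False by (auto simp: component_le_norm_cart)
      then have le: "(y $ i)\<^sup>2 \<le> ?r\<^sup>2" using power_mono[of ?a ?r 2] by simp
      then have l0: "0 \<le> ?L - ln (1 + (y $ i)\<^sup>2)" 
        using one_plus_square_pos[of "y $ i"] one_plus_square_pos[of ?r] by simp
      have "?L - ln (1 + (y $ i)\<^sup>2) = ln ((1 + ?r\<^sup>2) / (1 + (y $ i)\<^sup>2))"
        using one_plus_square_pos[of "y $ i"] one_plus_square_pos[of ?r] by (simp add: ln_div)
      also have "\<dots> \<le> ln ((?r / ?a)\<^sup>2)"
      proof (subst ln_le_cancel_iff)
        \<comment> \<open>As \<open>?a \<le> ?r\<close>, dropping both ones can only increase the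
          quotient.\<close>
        have "(1 + ?r\<^sup>2) / (1 + (y $ i)\<^sup>2) \<le> ?r\<^sup>2 / (y $ i)\<^sup>2"
          using le False one_plus_square_pos[of "y $ i"] by (simp add: field_simps)
        then show "(1 + ?r\<^sup>2) / (1 + (y $ i)\<^sup>2) \<le> (?r / ?a)\<^sup>2" by (simp add: power_divide)
      qed (use a one_plus_square_pos[of "y $ i"] one_plus_square_pos[of ?r] in auto)
      also have "\<dots> = 2 * ln (?r / ?a)" using a by (simp add: ln_realpow)
      also have "\<dots> \<le> 2 * (?r / ?a)"
        using a by (intro mult_left_mono less_imp_le[OF ln_less_self] divide_pos_pos) auto
      finally have "?a * (?L - ln (1 + (y $ i)\<^sup>2)) \<le> ?a * (2 * (?r / ?a))"
        using a by (intro mult_left_mono) auto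
      moreover have "\<bar>e $ i\<bar> = ?a * (?L - ln (1 + (y $ i)\<^sup>2))"
      proof -
        have "e $ i = y $ i * (?L - ln (1 + (y $ i)\<^sup>2))" by (simp add: e_def w_def algebra_simps)
        then show ?thesis using l0 by (simp only: abs_mult abs_of_nonneg)
      qed
      ultimately show ?thesis using a by simp
    qed (simp add: e_def w_def)
    have "norm e \<le> (\<Sum>i\<in>UNIV. \<bar>e $ i\<bar>)" by (rule norm_le_l1_cart)
    also have "\<dots> \<le> (\<Sum>i\<in>(UNIV::'m set). 2 * norm y)" by (intro sum_mono comp)
    finally have e: "norm e \<le> ?m * 2 * norm y" by simp
    have "y \<bullet> (A *v e) \<le> C * norm y * norm e" using C(2)[of y e] by linarith
    also have "\<dots> \<le> C * norm y * (?m * 2 * norm y)" using C e by (intro mult_left_mono) auto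
    finally have ye: "y \<bullet> (A *v e) \<le> C * (?m * 2) * (norm y)\<^sup>2" by (simp add: power2_eq_square mult_ac)
    have "?L * (c * (norm y)\<^sup>2) \<le> ?L * (y \<bullet> (A *v y))"
      using c by (intro mult_left_mono) auto
    moreover have "y \<bullet> (A *v w) = ?L * (y \<bullet> (A *v y)) - y \<bullet> (A *v e)"
    proof -
      have "w = ?L *\<^sub>R y - e" by (simp add: e_def)
      then show ?thesis by (simp add: matrix_vector_mult_diff_distrib matrix_vector_mult_scaleR inner_diff_right)
    qed
    ultimately have "(c * ?L - C * (?m * 2)) * (norm y)\<^sup>2 \<le> y \<bullet> (A *v w)"
      using ye by (simp add: algebra_simps)
    then have "2 * \<kappa> * ((c * ?L - C * (?m * 2)) * (norm y)\<^sup>2) \<le> 2 * \<kappa> * (y \<bullet> (A *v w))"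
      using \<kappa> by (intro mult_left_mono) auto
    \<comment> \<open>The second-order term has a sign and is dropped; the gain is then linear in
      \<kappa>, with constants valid for all \<kappa> \<ge> 0.\<close>
    moreover have "0 \<le> \<kappa>\<^sup>2 * (w \<bullet> (A *v w))" using positive_definite_nonneg[OF A] by simp
    moreover have "stretch_vec \<kappa> y = y + \<kappa> *\<^sub>R w"
      by (simp add: stretch_vec_def stretch_def w_def vec_eq_iff algebra_simps)
    then have "stretch_vec \<kappa> y \<bullet> (A *v stretch_vec \<kappa> y) =
        y \<bullet> (A *v y) + 2 * \<kappa> * (y \<bullet> (A *v w)) + \<kappa>\<^sup>2 * (w \<bullet> (A *v w))"
      using positive_definite_sym[OF A, of y w]
      by (simp add: matrix_vector_right_distrib matrix_vector_mult_scaleR inner_add_left inner_add_right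
          power2_eq_square algebra_simps)
    ultimately show ?thesis by linarith
  qed
  show ?thesis by (rule that[OF c(1) _ main]) (use C in auto)
qed

lemma stretch_jacobian_le:
  fixes y :: "real^'m"
  assumes "\<kappa> \<ge> 0"
  shows "stretch_jacobian \<kappa> y \<le> exp (real CARD('m) * (\<kappa> * (ln (1 + (norm y)\<^sup>2) + 2)))"
proof -
  have "stretch_jacobian \<kappa> y \<le> (\<Prod>i\<in>(UNIV::'m set). exp (\<kappa> * (ln (1 + (norm y)\<^sup>2) + 2)))"
    unfolding stretch_jacobian_def
    by (intro prod_mono conjI order_trans[OF zero_le_one stretch_deriv_ge_1]
        stretch_deriv_le component_le_norm_cart assms)
  then show ?thesis by (simp add: exp_of_nat_mult)
qed

text \<open>Gain, loss and Jacobian all enter the exponent with the factor \<kappa>, and what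
  multiplies it is at most K \<ge> 0; \<kappa> \<le> 1 therefore gives one constant for all
  \<kappa>. It supplies the majorant for the limit.\<close>

lemma gauss_kernel_stretch_bound_uniform:
  fixes S :: "real^'m^'m"
  assumes S: "positive_definite S"
  obtains K where "\<And>\<kappa> y. 0 \<le> \<kappa> \<Longrightarrow> \<kappa> \<le> 1 \<Longrightarrow>
    gauss_kernel S (stretch_vec \<kappa> y) * stretch_jacobian \<kappa> y \<le> K * gauss_kernel S y"
proof -
  let ?A = "matrix_inv S" and ?m = "real CARD('m)"
  obtain c D where cD: "c > 0" "D \<ge> 0"
    "\<And>\<kappa> y. \<kappa> \<ge> 0 \<Longrightarrow> y \<bullet> (?A *v y) + 2 * \<kappa> * ((c * ln (1 + (norm y)\<^sup>2) - D) * (norm y)\<^sup>2) \<le>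
      stretch_vec \<kappa> y \<bullet> (?A *v stretch_vec \<kappa> y)"
    using stretch_form_ge[OF positive_definite_matrix_inv[OF S]] by blast
  obtain K where K: "K \<ge> 0" "\<And>N::real. - (c * ln (1 + N\<^sup>2) * N\<^sup>2) + D * N\<^sup>2 + ?m * (ln (1 + N\<^sup>2) + 2) \<le> K"
    using log_square_dominates[OF cD(1,2), of ?m] by auto
  have "gauss_kernel S (stretch_vec \<kappa> y) * stretch_jacobian \<kappa> y \<le> exp K * gauss_kernel S y"
    if \<kappa>: "0 \<le> \<kappa>" "\<kappa> \<le> 1" for \<kappa> and y :: "real^'m"
  proof -
    let ?L = "ln (1 + (norm y)\<^sup>2)" and ?N = "(norm y)\<^sup>2"
    have "gauss_kernel S (stretch_vec \<kappa> y) * stretch_jacobian \<kappa> y \<le>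
      gauss_kernel S (stretch_vec \<kappa> y) * exp (?m * (\<kappa> * (?L + 2)))"
      by (intro mult_left_mono stretch_jacobian_le \<kappa>) simp
    also have "\<dots> = exp (- (stretch_vec \<kappa> y \<bullet> (?A *v stretch_vec \<kappa> y)) / 2 + ?m * (\<kappa> * (?L + 2)))"
      by (simp only: gauss_kernel_def exp_add)
    also have "\<dots> \<le> exp (K + (- (y \<bullet> (?A *v y)) / 2))"
    proof -
      have "\<kappa> * (- (c * ?L * ?N) + D * ?N + ?m * (?L + 2)) \<le> \<kappa> * K"
        using \<kappa> K by (intro mult_left_mono) auto
      also have "\<dots> \<le> K" using \<kappa> K mult_right_mono[of \<kappa> 1 K] by simp
      finally show ?thesis using cD(3)[OF \<kappa>(1), of y] by (simp add: algebra_simps)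
    qed
    finally show ?thesis by (simp only: gauss_kernel_def exp_add)
  qed
  then show ?thesis using that by blast
qed

text \<open>At a fixed \<kappa> > 0 the logarithm makes the stretched form of T outgrow every
  multiple of |y|^2, including the form of S, however different the covariances are. The constant
  may depend on \<kappa>.\<close>

lemma gauss_kernel_stretch_bound:
  fixes S T :: "real^'m^'m"
  assumes T: "positive_definite T" and \<kappa>: "\<kappa> > 0"
  obtains K where "\<And>y. gauss_kernel T (stretch_vec \<kappa> y) * stretch_jacobian \<kappa> y \<le> K * gauss_kernel S y"
proof -
  let ?A = "matrix_inv T" and ?B = "matrix_inv S" and ?m = "real CARD('m)"
  obtain c D where cD: "c > 0" "D \<ge> 0"
    "\<And>\<kappa> y. \<kappa> \<ge> 0 \<Longrightarrow> y \<bullet> (?A *v y) + 2 * \<kappa> * ((c * ln (1 + (norm y)\<^sup>2) - D) * (norm y)\<^sup>2) \<le>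
      stretch_vec \<kappa> y \<bullet> (?A *v stretch_vec \<kappa> y)"
    using stretch_form_ge[OF positive_definite_matrix_inv[OF T]] by blast
  obtain C where C: "C \<ge> 0" "\<And>x y. \<bar>x \<bullet> (?B *v y)\<bar> \<le> C * norm x * norm y"
    using matrix_form_bound by metis
  \<comment> \<open>The summand \<open>C / 2\<close> pays for the form of S, which enters its kernel
    with the factor 1/2.\<close>
  obtain K where K: "K \<ge> 0"
    "\<And>N::real. - (\<kappa> * c * ln (1 + N\<^sup>2) * N\<^sup>2) + (\<kappa> * D + C / 2) * N\<^sup>2 + (?m * \<kappa>) * (ln (1 + N\<^sup>2) + 2) \<le> K"
    using log_square_dominates[of "\<kappa> * c" "\<kappa> * D + C / 2" "?m * \<kappa>"] cD C \<kappa> by auto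
  have "gauss_kernel T (stretch_vec \<kappa> y) * stretch_jacobian \<kappa> y \<le> exp K * gauss_kernel S y" for y
  proof -
    let ?L = "ln (1 + (norm y)\<^sup>2)" and ?N = "(norm y)\<^sup>2"
    have "gauss_kernel T (stretch_vec \<kappa> y) * stretch_jacobian \<kappa> y \<le>
      gauss_kernel T (stretch_vec \<kappa> y) * exp (?m * (\<kappa> * (?L + 2)))"
      by (intro mult_left_mono stretch_jacobian_le less_imp_le[OF \<kappa>]) simp
    also have "\<dots> = exp (- (stretch_vec \<kappa> y \<bullet> (?A *v stretch_vec \<kappa> y)) / 2 + ?m * (\<kappa> * (?L + 2)))"
      by (simp only: gauss_kernel_def exp_add)
    also have "\<dots> \<le> exp (K + (- (y \<bullet> (?B *v y)) / 2))"
    proof -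
      have "0 \<le> y \<bullet> (?A *v y)"
        by (rule positive_definite_nonneg[OF positive_definite_matrix_inv[OF T]])
      moreover have "y \<bullet> (?B *v y) \<le> C * ?N" using C(2)[of y y] by (simp add: power2_eq_square mult_ac)
      ultimately show ?thesis
        using cD(3)[of \<kappa> y] \<kappa> K(2)[of "norm y"] by (simp add: algebra_simps)
    qed
    finally show ?thesis by (simp only: gauss_kernel_def exp_add)
  qed
  then show ?thesis using that by blast
qed

section \<open>Integrability along the segment and the limit of vanishing stretch\<close>

lemma integrable_gaussian_iff:
  fixes S :: "real^'m^'m" and F :: "real^'m \<Rightarrow> real"
  assumes S: "positive_definite S" and [measurable]: "F \<in> borel_measurable borel"
  shows "integrable (gaussian S) F \<longleftrightarrow> integrable lborel (\<lambda>z. F z * gauss_density S z)"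
  unfolding gaussian_def
  by (subst integrable_density) (simp_all add: gauss_density_nonneg[OF S] mult.commute)

lemma integral_gaussian:
  fixes S :: "real^'m^'m" and F :: "real^'m \<Rightarrow> real"
  assumes S: "positive_definite S" and [measurable]: "F \<in> borel_measurable borel"
  shows "(\<integral>z. F z \<partial>gaussian S) = (\<integral>z. F z * gauss_density S z \<partial>lborel)"
  unfolding gaussian_def
  by (subst integral_density) (simp_all add: gauss_density_nonneg[OF S] mult.commute)

text \<open>After the substitution F is weighted by the density of T at the stretched point times
  the Jacobian, and a multiple of the density of S dominates this weight. Integrability under one
  Gaussian law thus passes to all of them.\<close>

lemma integrable_gaussian_shrink:
  fixes S T :: "real^'m^'m" and F :: "real^'m \<Rightarrow> real"
  assumes S: "positive_definite S" and T: "positive_definite T" and \<kappa>: "\<kappa> > 0"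
    and [measurable]: "F \<in> borel_measurable borel" and int: "integrable (gaussian S) F"
  shows "integrable (gaussian T) (\<lambda>x. F (shrink_vec \<kappa> x))"
proof -
  have k: "\<kappa> \<ge> 0" using \<kappa> by simp
  note [measurable] = borel_measurable_shrink_vec[OF k]
  obtain K where K: "\<And>y. gauss_kernel T (stretch_vec \<kappa> y) * stretch_jacobian \<kappa> y \<le> K * gauss_kernel S y"
    using gauss_kernel_stretch_bound[OF T \<kappa>] by blast
  let ?K = "K * gauss_norm S / gauss_norm T"
  note pos = gauss_norm_pos[OF S] gauss_norm_pos[OF T]
  have bound: "gauss_density T (stretch_vec \<kappa> y) * stretch_jacobian \<kappa> y \<le> ?K * gauss_density S y" for y
    using K[of y] pos by (simp add: gauss_density_def divide_right_mono)
  have "integrable lborel (\<lambda>y. F y * (gauss_density T (stretch_vec \<kappa> y) * stretch_jacobian \<kappa> y))"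
  proof (rule Bochner_Integration.integrable_bound)
    show "integrable lborel (\<lambda>y. ?K * (F y * gauss_density S y))"
      using int by (intro integrable_mult_right) (simp add: integrable_gaussian_iff[OF S])
    show "AE y in lborel. norm (F y * (gauss_density T (stretch_vec \<kappa> y) * stretch_jacobian \<kappa> y))
        \<le> norm (?K * (F y * gauss_density S y))"
    proof (rule AE_I2)
      fix y
      have nn: "0 \<le> gauss_density T (stretch_vec \<kappa> y) * stretch_jacobian \<kappa> y"
        by (intro mult_nonneg_nonneg gauss_density_nonneg T stretch_jacobian_nonneg k)
      then have "\<bar>F y\<bar> * (gauss_density T (stretch_vec \<kappa> y) * stretch_jacobian \<kappa> y) \<le>
          \<bar>F y\<bar> * (?K * gauss_density S y)"
        by (intro mult_left_mono bound) simp
      moreover have "0 \<le> ?K * gauss_density S y" using nn bound[of y] by linarith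
      ultimately show "norm (F y * (gauss_density T (stretch_vec \<kappa> y) * stretch_jacobian \<kappa> y))
        \<le> norm (?K * (F y * gauss_density S y))"
        using nn by (simp only: real_norm_def abs_mult[of "F y"] abs_of_nonneg mult.left_commute[of ?K])
    qed
  qed simp
  then show ?thesis
    unfolding integrable_gaussian_iff[OF T measurable_compose[OF borel_measurable_shrink_vec[OF k] assms(4)]]
    by (subst integral_shrink(1)[OF k]) simp_all
qed

text \<open>Convergence takes place in the weight, pointwise in y with F y as a fixed factor; no
  continuity of F enters.\<close>

lemma gaussian_shrink_tendsto:
  fixes S :: "real^'m^'m" and F :: "real^'m \<Rightarrow> real"
  assumes S: "positive_definite S"
    and [measurable]: "F \<in> borel_measurable borel" and int: "integrable (gaussian S) F"
    and k: "\<And>n. 0 \<le> k n" "\<And>n. k n \<le> 1" and k0: "k \<longlonglongrightarrow> (0 :: real)"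
  shows "(\<lambda>n. \<integral>x. F (shrink_vec (k n) x) \<partial>gaussian S) \<longlonglongrightarrow> (\<integral>x. F x \<partial>gaussian S)"
proof -
  note [measurable] = borel_measurable_shrink_vec[OF k(1)]
  obtain K where K: "\<And>\<kappa> y. 0 \<le> \<kappa> \<Longrightarrow> \<kappa> \<le> 1 \<Longrightarrow>
    gauss_kernel S (stretch_vec \<kappa> y) * stretch_jacobian \<kappa> y \<le> K * gauss_kernel S y"
    using gauss_kernel_stretch_bound_uniform[OF S] by blast
  have bound: "gauss_density S (stretch_vec (k n) y) * stretch_jacobian (k n) y \<le> K * gauss_density S y" for n y
    using K[OF k, of n y] gauss_norm_pos[OF S] by (simp add: gauss_density_def divide_right_mono)
  have lim: "(\<lambda>n. gauss_density S (stretch_vec (k n) y) * stretch_jacobian (k n) y) \<longlonglongrightarrow> gauss_density S y" for y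
  proof -
    have "(\<lambda>n. stretch_vec (k n) y) \<longlonglongrightarrow> (\<chi> i. y $ i * (1 + 0 * ln (1 + (y $ i)\<^sup>2)))"
      unfolding stretch_vec_def stretch_def by (intro tendsto_intros k0)
    then have "(\<lambda>n. stretch_vec (k n) y) \<longlonglongrightarrow> y" by simp
    moreover have "isCont (gauss_density S) y"
      unfolding gauss_density_def[abs_def] gauss_kernel_def
      by (intro continuous_intros linear_continuous_at matrix_vector_mul_bounded_linear)
        (use gauss_norm_pos[OF S] in auto)
    ultimately have 1: "(\<lambda>n. gauss_density S (stretch_vec (k n) y)) \<longlonglongrightarrow> gauss_density S y"
      by (rule isCont_tendsto_compose[rotated])
    have 2: "(\<lambda>n. stretch_jacobian (k n) y) \<longlonglongrightarrow>
      (\<Prod>i\<in>UNIV. 1 + 0 * (ln (1 + (y $ i)\<^sup>2) + 2 * (y $ i)\<^sup>2 / (1 + (y $ i)\<^sup>2)))"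
      unfolding stretch_jacobian_def stretch_deriv_def by (intro tendsto_intros k0)
    from tendsto_mult[OF 1 2] show ?thesis by simp
  qed
  have "(\<lambda>n. \<integral>y. F y * (gauss_density S (stretch_vec (k n) y) * stretch_jacobian (k n) y) \<partial>lborel) \<longlonglongrightarrow>
     (\<integral>y. F y * gauss_density S y \<partial>lborel)"
  proof (rule integral_dominated_convergence)
    show "integrable lborel (\<lambda>y. \<bar>K\<bar> * \<bar>F y * gauss_density S y\<bar>)"
      using int by (intro integrable_mult_right integrable_abs) (simp add: integrable_gaussian_iff[OF S])
    show "AE y in lborel. (\<lambda>n. F y * (gauss_density S (stretch_vec (k n) y) * stretch_jacobian (k n) y))
        \<longlonglongrightarrow> F y * gauss_density S y"
      by (intro AE_I2 tendsto_mult_left lim)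
    show "AE y in lborel. norm (F y * (gauss_density S (stretch_vec (k n) y) * stretch_jacobian (k n) y))
        \<le> \<bar>K\<bar> * \<bar>F y * gauss_density S y\<bar>" for n
    proof (rule AE_I2)
      fix y
      let ?g = "gauss_density S (stretch_vec (k n) y) * stretch_jacobian (k n) y"
      have nn: "0 \<le> ?g"
        by (intro mult_nonneg_nonneg gauss_density_nonneg S stretch_jacobian_nonneg k)
      have "?g \<le> \<bar>K\<bar> * gauss_density S y"
        using bound[of n y] mult_right_mono[OF abs_ge_self[of K] gauss_density_nonneg[OF S, of y]] by linarith
      then have "\<bar>F y\<bar> * ?g \<le> \<bar>F y\<bar> * (\<bar>K\<bar> * gauss_density S y)"
        by (rule mult_left_mono) simp
      then show "norm (F y * ?g) \<le> \<bar>K\<bar> * \<bar>F y * gauss_density S y\<bar>"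
        using nn gauss_density_nonneg[OF S, of y]
        by (simp only: real_norm_def abs_mult[of "F y"] abs_of_nonneg mult.left_commute)
    qed
  qed simp_all
  moreover have "(\<integral>x. F (shrink_vec (k n) x) \<partial>gaussian S) =
     (\<integral>y. F y * (gauss_density S (stretch_vec (k n) y) * stretch_jacobian (k n) y) \<partial>lborel)" for n
    unfolding integral_gaussian[OF S measurable_compose[OF borel_measurable_shrink_vec[OF k(1)] assms(2)]]
    by (subst integral_shrink(2)[OF k(1)]) simp_all
  ultimately show ?thesis
    by (simp only: integral_gaussian[OF S assms(2)])
qed

text \<open>A monotone coordinatewise map turns a nonnegative increment of one coordinate into a
  nonnegative increment of the same coordinate, and for distinct coordinates the two do not
  interact.\<close>

lemma supermodular_vec_shrink:
  assumes F: "supermodular_vec F" and \<kappa>: "\<kappa> \<ge> 0"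
  shows "supermodular_vec (\<lambda>x. F (shrink_vec \<kappa> x))"
  unfolding supermodular_vec_def
proof (intro allI impI)
  fix x :: "real^'a" and i j :: 'a and \<epsilon> \<eta> :: real
  assume ij: "i \<noteq> j" and pos: "0 \<le> \<epsilon>" "0 \<le> \<eta>"
  let ?d = "\<lambda>i \<epsilon>. shrink \<kappa> (x $ i + \<epsilon>) - shrink \<kappa> (x $ i)"
  have d: "0 \<le> ?d i \<epsilon>" "0 \<le> ?d j \<eta>"
    using monoD[OF mono_shrink[OF \<kappa>]] pos by simp_all
  have "shrink_vec \<kappa> (x + \<epsilon> *\<^sub>R axis i 1) = shrink_vec \<kappa> x + ?d i \<epsilon> *\<^sub>R axis i 1"
    "shrink_vec \<kappa> (x + \<eta> *\<^sub>R axis j 1) = shrink_vec \<kappa> x + ?d j \<eta> *\<^sub>R axis j 1"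
    "shrink_vec \<kappa> (x + \<epsilon> *\<^sub>R axis i 1 + \<eta> *\<^sub>R axis j 1) =
      shrink_vec \<kappa> x + ?d i \<epsilon> *\<^sub>R axis i 1 + ?d j \<eta> *\<^sub>R axis j 1"
    using ij by (auto simp: shrink_vec_def vec_eq_iff axis_def)
  then show "F (shrink_vec \<kappa> (x + \<epsilon> *\<^sub>R axis i 1)) + F (shrink_vec \<kappa> (x + \<eta> *\<^sub>R axis j 1)) \<le>
    F (shrink_vec \<kappa> (x + \<epsilon> *\<^sub>R axis i 1 + \<eta> *\<^sub>R axis j 1)) + F (shrink_vec \<kappa> x)"
    using supermodular_vecD[OF F ij d, of "shrink_vec \<kappa> x"] by simp
qed

lemma supermodular_gaussian:
  fixes S T :: "real^'m^'m" and F :: "real^'m \<Rightarrow> real"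
  assumes S: "positive_definite S" and T: "positive_definite T"
    and diag: "\<And>i. S $ i $ i = T $ i $ i" and le: "\<And>i j. S $ i $ j \<le> T $ i $ j"
    and F: "supermodular_vec F" "F \<in> borel_measurable borel"
    and int: "integrable (gaussian S) F" "integrable (gaussian T) F"
  shows "(\<integral>z. F z \<partial>gaussian S) \<le> (\<integral>z. F z \<partial>gaussian T)"
proof (rule LIMSEQ_le)
  \<comment> \<open>These values lie in (0, 1]: positivity gives integrability under all
    covariances, the bound 1 the uniform majorant.\<close>
  have k: "0 \<le> 1 / real (Suc n)" "1 / real (Suc n) \<le> 1" "(\<lambda>n. 1 / real (Suc n)) \<longlonglongrightarrow> 0" for n
    using LIMSEQ_inverse_real_of_nat by (simp_all add: inverse_eq_divide)
  show "(\<lambda>n. \<integral>x. F (shrink_vec (1 / real (Suc n)) x) \<partial>gaussian S) \<longlonglongrightarrow> (\<integral>x. F x \<partial>gaussian S)"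
    by (rule gaussian_shrink_tendsto[OF S F(2) int(1) k])
  show "(\<lambda>n. \<integral>x. F (shrink_vec (1 / real (Suc n)) x) \<partial>gaussian T) \<longlonglongrightarrow> (\<integral>x. F x \<partial>gaussian T)"
    by (rule gaussian_shrink_tendsto[OF T F(2) int(2) k])
  have "(\<integral>x. F (shrink_vec (1 / real (Suc n)) x) \<partial>gaussian S) \<le>
      (\<integral>x. F (shrink_vec (1 / real (Suc n)) x) \<partial>gaussian T)" for n
  proof (rule supermodular_gaussian_all_integrable[OF S T diag le])
    show "supermodular_vec (\<lambda>x. F (shrink_vec (1 / real (Suc n)) x))"
      by (rule supermodular_vec_shrink[OF F(1)]) simp
    show "(\<lambda>x. F (shrink_vec (1 / real (Suc n)) x)) \<in> borel_measurable borel"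
      using F(2) borel_measurable_shrink_vec[of "1 / real (Suc n)"]
      by (auto intro: measurable_compose)
    show "integrable (gaussian C) (\<lambda>x. F (shrink_vec (1 / real (Suc n)) x))" if "positive_definite C" for C
      by (rule integrable_gaussian_shrink[OF S that _ F(2) int(1)]) simp
  qed
  then show "\<exists>N. \<forall>n\<ge>N. (\<integral>x. F (shrink_vec (1 / real (Suc n)) x) \<partial>gaussian S) \<le>
      (\<integral>x. F (shrink_vec (1 / real (Suc n)) x) \<partial>gaussian T)" by blast
qed

section \<open>Skew-normal laws\<close>

text \<open>Reflection and rescaling u = m - s y. This is the origin of the factor \<Phi> in the
  skew-normal density: it is the probability that a normal u with mean m and deviation s is
  positive.\<close>

lemma nn_integral_normal_density_positive:
  assumes s: "s > 0"
  shows "(\<integral>\<^sup>+u. ennreal (normal_density m s u) * indicator {0<..} u \<partial>lborel) =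
    ennreal (cdf std_normal_distribution (m / s))"
proof -
  interpret N: prob_space std_normal_distribution by (rule prob_space_std_normal)
  have "(\<integral>\<^sup>+u. ennreal (normal_density m s u) * indicator {0<..} u \<partial>lborel) =
      ennreal s * (\<integral>\<^sup>+y. ennreal (normal_density m s (m - s * y)) * indicator {0<..} (m - s * y) \<partial>lborel)"
    using s nn_integral_real_affine[of "\<lambda>u. ennreal (normal_density m s u) * indicator {0<..} u" "- s" m]
    by simp
  also have "\<dots> = (\<integral>\<^sup>+y. ennreal s * (ennreal (normal_density m s (m - s * y)) * indicator {0<..} (m - s * y)) \<partial>lborel)"
    by (rule nn_integral_cmult[symmetric]) simp
  also have "\<dots> = (\<integral>\<^sup>+y. ennreal (std_normal_density y) * indicator {..m / s} y \<partial>lborel)"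
  proof (rule nn_integral_cong_AE)
    have dens: "s * normal_density m s (m - s * y) = std_normal_density y" for y
      using s by (simp add: normal_density_def real_sqrt_mult power_mult_distrib)
    \<comment> \<open>The substitution yields a strict inequality and the distribution function a
      closed half-line; they differ in the null set of the point m / s.\<close>
    show "AE y in lborel. ennreal s * (ennreal (normal_density m s (m - s * y)) * indicator {0<..} (m - s * y)) =
        ennreal (std_normal_density y) * indicator {..m / s} y"
      using AE_lborel_singleton[of "m / s"]
    proof eventually_elim
      case (elim y)
      then have "0 < m - s * y \<longleftrightarrow> y \<le> m / s" using s by (auto simp: field_simps)
      then show ?case
        using s by (simp add: indicator_def mult.assoc[symmetric] ennreal_mult'[symmetric] dens)
    qed
  qed
  also have "\<dots> = emeasure std_normal_distribution {..m / s}"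
    by (simp add: emeasure_density)
  also have "\<dots> = ennreal (cdf std_normal_distribution (m / s))"
    by (simp add: cdf_def N.emeasure_eq_measure)
  finally show ?thesis .
qed

lemma cdf_std_normal_uminus:
  "ennreal (cdf std_normal_distribution x) + ennreal (cdf std_normal_distribution (- x)) = 1"
proof -
  have 1: "ennreal (cdf std_normal_distribution y) =
    (\<integral>\<^sup>+u. ennreal (normal_density y 1 u) * indicator {0<..} u \<partial>lborel)" for y
    using nn_integral_normal_density_positive[of 1 y] by simp
  have "(\<integral>\<^sup>+u. ennreal (normal_density (- x) 1 u) * indicator {0<..} u \<partial>lborel) =
      (\<integral>\<^sup>+u. ennreal (normal_density (- x) 1 (- u)) * indicator {0<..} (- u) \<partial>lborel)"
    using nn_integral_real_affine[of "\<lambda>u. ennreal (normal_density (- x) 1 u) * indicator {0<..} u" "- 1" 0]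
    by simp
  also have "\<dots> = (\<integral>\<^sup>+u. ennreal (normal_density x 1 u) * indicator {..<0} u \<partial>lborel)"
    by (intro nn_integral_cong) (simp add: normal_density_def indicator_def power2_commute)
  finally have "ennreal (cdf std_normal_distribution x) + ennreal (cdf std_normal_distribution (- x)) =
      (\<integral>\<^sup>+u. ennreal (normal_density x 1 u) * indicator {0<..} u + ennreal (normal_density x 1 u) * indicator {..<0} u \<partial>lborel)"
    unfolding 1 by (simp add: nn_integral_add)
  also have "\<dots> = (\<integral>\<^sup>+u. ennreal (normal_density x 1 u) \<partial>lborel)"
  proof (rule nn_integral_cong_AE)
    show "AE u in lborel. ennreal (normal_density x 1 u) * indicator {0<..} u +
        ennreal (normal_density x 1 u) * indicator {..<0} u = ennreal (normal_density x 1 u)"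
      using AE_lborel_singleton[of "0::real"] by eventually_elim (auto simp: indicator_def)
  qed
  also have "\<dots> = 1" by (simp add: nn_integral_eq_integral)
  finally show ?thesis .
qed

lemma nn_integral_lborel_uminus:
  fixes f :: "'a::euclidean_space \<Rightarrow> ennreal"
  assumes [measurable]: "f \<in> borel_measurable borel"
  shows "(\<integral>\<^sup>+z. f (- z) \<partial>lborel) = (\<integral>\<^sup>+z. f z \<partial>lborel)"
proof -
  have lb: "lborel = density (distr lborel borel (\<lambda>x::'a. 0 + (- 1) *\<^sub>R x)) (\<lambda>_. ennreal (\<bar>- 1 :: real\<bar> ^ DIM('a)))"
    by (rule lborel_affine) simp
  have "(\<integral>\<^sup>+z. f z \<partial>lborel) =
    (\<integral>\<^sup>+z. f z \<partial>density (distr lborel borel (\<lambda>x::'a. 0 + (- 1) *\<^sub>R x)) (\<lambda>_. ennreal (\<bar>- 1 :: real\<bar> ^ DIM('a))))"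
    using lb by (rule arg_cong)
  also have "\<dots> = (\<integral>\<^sup>+z. f (- z) \<partial>lborel)"
    by (simp add: nn_integral_density nn_integral_distr)
  finally show ?thesis by simp
qed

lemma borel_measurable_cdf_std_normal [measurable]: "cdf std_normal_distribution \<in> borel_measurable borel"
proof -
  interpret real_distribution std_normal_distribution by (rule real_dist_normal_dist)
  show ?thesis by (rule borel_measurable_mono) (simp add: mono_def cdf_nondecreasing)
qed

text \<open>Average over z and -z and use \<Phi>(t) + \<Phi>(-t) = 1. Even functions do not see the
  skewness, which settles both the normalisation and the second moments.\<close>

lemma nn_integral_even_skew:
  fixes G :: "real^'m \<Rightarrow> ennreal"
  assumes [measurable]: "G \<in> borel_measurable borel" and even: "\<And>z. G (- z) = G z"
  shows "2 * (\<integral>\<^sup>+z. G z * ennreal (cdf std_normal_distribution (\<alpha> \<bullet> z)) \<partial>lborel) = (\<integral>\<^sup>+z. G z \<partial>lborel)"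
proof -
  let ?\<Phi> = "cdf std_normal_distribution"
  let ?I = "\<integral>\<^sup>+z. G z * ennreal (?\<Phi> (\<alpha> \<bullet> z)) \<partial>lborel"
  have "?I = (\<integral>\<^sup>+z. G z * ennreal (?\<Phi> (- (\<alpha> \<bullet> z))) \<partial>lborel)"
    using nn_integral_lborel_uminus[of "\<lambda>z. G z * ennreal (?\<Phi> (\<alpha> \<bullet> z))"] by (simp add: even)
  then have "2 * ?I = ?I + (\<integral>\<^sup>+z. G z * ennreal (?\<Phi> (- (\<alpha> \<bullet> z))) \<partial>lborel)"
    by (simp add: mult_2)
  also have "\<dots> = (\<integral>\<^sup>+z. G z * (ennreal (?\<Phi> (\<alpha> \<bullet> z)) + ennreal (?\<Phi> (- (\<alpha> \<bullet> z)))) \<partial>lborel)"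
    by (simp add: nn_integral_add distrib_left)
  finally show ?thesis by (simp add: cdf_std_normal_uminus)
qed

lemma gauss_density_uminus [simp]: "gauss_density S (- z) = gauss_density S z"
  using matrix_vector_mult_scaleR[of "matrix_inv S" "- 1" z] by (simp add: gauss_density_def gauss_kernel_def)

lemma gauss_kernel_uminus [simp]: "gauss_kernel S (- z) = gauss_kernel S z"
  using matrix_vector_mult_scaleR[of "matrix_inv S" "- 1" z] by (simp add: gauss_kernel_def)

lemma matrix_inv_eq:
  fixes A :: "real^'m^'m"
  assumes "A ** B = mat 1"
  shows "matrix_inv A = B"
proof -
  have "B ** A = mat 1" using assms by (simp add: matrix_left_right_inverse)
  then have "\<exists>C. A ** C = mat 1 \<and> C ** A = mat 1" using assms by blast
  then have "matrix_inv A ** A = mat 1" unfolding matrix_inv_def by (rule someI2_ex) simp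
  then have "matrix_inv A ** A ** B = B" by simp
  then show ?thesis using assms by (simp add: matrix_mul_assoc[symmetric])
qed

lemma scale_diag_unit:
  assumes "\<And>i. \<Omega> $ i $ i = 1"
  shows "scale_diag \<Omega> = mat 1"
  using assms by (simp add: scale_diag_def mat_def vec_eq_iff)

lemma diagonal_matrix_mult:
  fixes A :: "real^'m^'m"
  shows "(\<chi> i j. if i = j then d i else 0) ** A = (\<chi> i j. d i * A $ i $ j)"
    and "A ** (\<chi> i j. if i = j then d i else 0) = (\<chi> i j. A $ i $ j * d j)"
proof -
  have "(\<Sum>k\<in>UNIV. (if i = k then d i else 0) * A $ k $ j) = (\<Sum>k\<in>UNIV. if k = i then d i * A $ i $ j else 0)" for i j
    by (intro sum.cong) auto
  then show "(\<chi> i j. if i = j then d i else 0) ** A = (\<chi> i j. d i * A $ i $ j)"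
    by (simp add: matrix_matrix_mult_def)
  have "(\<Sum>k\<in>UNIV. A $ i $ k * (if k = j then d k else 0)) = (\<Sum>k\<in>UNIV. if k = j then A $ i $ j * d j else 0)" for i j
    by (intro sum.cong) auto
  then show "A ** (\<chi> i j. if i = j then d i else 0) = (\<chi> i j. A $ i $ j * d j)"
    by (simp add: matrix_matrix_mult_def)
qed

lemma correlation_matrix_diag:
  assumes pos: "\<And>i. \<Omega> $ i $ i > 0"
  shows "correlation_matrix \<Omega> $ i $ i = 1"
proof -
  let ?D = "\<chi> i j. if i = j then 1 / sqrt (\<Omega> $ i $ i) else 0"
  have "sqrt (\<Omega> $ i $ i) \<noteq> 0" for i using pos[of i] by simp
  then have inv: "matrix_inv (scale_diag \<Omega>) = ?D"
    by (intro matrix_inv_eq) (simp add: scale_diag_def diagonal_matrix_mult mat_def vec_eq_iff)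
  have "correlation_matrix \<Omega> $ i $ i = 1 / sqrt (\<Omega> $ i $ i) * \<Omega> $ i $ i * (1 / sqrt (\<Omega> $ i $ i))"
    unfolding correlation_matrix_def inv by (simp only: diagonal_matrix_mult vec_lambda_beta)
  also have "\<dots> = 1" using pos[of i] by (simp add: field_simps)
  finally show ?thesis .
qed

text \<open>The normalising constant of \<open>mvn_density\<close> agrees with \<open>gauss_norm\<close> since otherwise the
  skew-normal density would not have total mass 1.\<close>

lemma sn_density_eq:
  fixes \<Omega> :: "real^'m^'m"
  assumes P: "prob_space P" and \<Omega>: "positive_definite \<Omega>" and unit: "\<And>i. \<Omega> $ i $ i = 1"
    and Z: "distributed P lborel Z (\<lambda>z. ennreal (sn_density 0 \<Omega> \<alpha> z))"
  shows "sn_density 0 \<Omega> \<alpha> z = 2 * gauss_density \<Omega> z * cdf std_normal_distribution (\<alpha> \<bullet> z)"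
proof -
  let ?\<Phi> = "cdf std_normal_distribution"
  interpret N: real_distribution std_normal_distribution by (rule real_dist_normal_dist)
  interpret P: prob_space P by (rule P)
  define K where "K = sqrt ((2 * pi) ^ CARD('m) * det \<Omega>)"
  have inv1: "matrix_inv (mat 1 :: real^'m^'m) = mat 1" by (rule matrix_inv_eq) simp
  have sn: "sn_density 0 \<Omega> \<alpha> z = (1 / K) * (2 * (gauss_kernel \<Omega> z * ?\<Phi> (\<alpha> \<bullet> z)))" for z
    by (simp add: sn_density_def mvn_density_def scale_diag_unit[OF unit] inv1 gauss_kernel_def K_def)
  have nonneg: "0 \<le> ?\<Phi> x" for x by (rule N.cdf_nonneg)
  have kern: "(\<integral>\<^sup>+z. gauss_kernel \<Omega> z \<partial>lborel) = gauss_norm \<Omega>"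
    unfolding gauss_norm_def using integrable_gauss_kernel[OF \<Omega>]
    by (intro nn_integral_eq_integral) auto
  have "(\<integral>\<^sup>+z. ennreal (2 * (gauss_kernel \<Omega> z * ?\<Phi> (\<alpha> \<bullet> z))) \<partial>lborel) =
      2 * (\<integral>\<^sup>+z. ennreal (gauss_kernel \<Omega> z) * ennreal (?\<Phi> (\<alpha> \<bullet> z)) \<partial>lborel)"
    by (subst nn_integral_cmult[symmetric]) (simp_all add: ennreal_mult' ennreal_mult'' nonneg)
  also have "\<dots> = gauss_norm \<Omega>"
    by (subst nn_integral_even_skew) (simp_all add: kern)
  finally have mass: "(\<integral>\<^sup>+z. ennreal (2 * (gauss_kernel \<Omega> z * ?\<Phi> (\<alpha> \<bullet> z))) \<partial>lborel) = gauss_norm \<Omega>" .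
  have one: "(\<integral>\<^sup>+z. ennreal (sn_density 0 \<Omega> \<alpha> z) \<partial>lborel) = 1"
    using distributed_nn_integral[OF Z, of "\<lambda>_. 1"] P.emeasure_space_1 by simp
  \<comment> \<open>The sign of the determinant has not been computed. If it were not positive, the
    conventions for division by 0 and for roots of negative numbers would make the density
    nonpositive, with total mass 0.\<close>
  have "K > 0"
  proof (rule ccontr)
    assume "\<not> K > 0"
    then have "sn_density 0 \<Omega> \<alpha> z \<le> 0" for z
      unfolding sn using nonneg by (intro mult_nonpos_nonneg) auto
    then have "(\<integral>\<^sup>+z. ennreal (sn_density 0 \<Omega> \<alpha> z) \<partial>lborel) = 0" by (simp add: ennreal_neg)
    then show False using one by simp
  qed
  then have "(\<integral>\<^sup>+z. ennreal (sn_density 0 \<Omega> \<alpha> z) \<partial>lborel) =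
      ennreal (1 / K) * (\<integral>\<^sup>+z. ennreal (2 * (gauss_kernel \<Omega> z * ?\<Phi> (\<alpha> \<bullet> z))) \<partial>lborel)"
    unfolding sn by (subst nn_integral_cmult[symmetric], simp) (intro nn_integral_cong ennreal_mult', simp)
  then have "ennreal (gauss_norm \<Omega> / K) = 1"
    unfolding mass one using \<open>K > 0\<close> by (simp add: ennreal_mult'[symmetric])
  then have "K = gauss_norm \<Omega>" using \<open>K > 0\<close> by simp
  then show ?thesis unfolding sn by (simp add: gauss_density_def)
qed

section \<open>The half-normal law and Gaussian moments\<close>

definition half_normal :: "real measure" where
  "half_normal = density lborel (\<lambda>u. 2 * (ennreal (std_normal_density u) * indicator {0<..} u))"

lemma sets_half_normal [simp, measurable_cong]: "sets half_normal = sets borel"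
  by (simp add: half_normal_def)

lemma prob_space_half_normal: "prob_space half_normal"
proof (rule prob_spaceI)
  let ?\<Phi>0 = "ennreal (cdf std_normal_distribution 0)"
  have "emeasure half_normal (space half_normal) = 2 * ?\<Phi>0"
    using nn_integral_normal_density_positive[of 1 0]
    by (simp add: half_normal_def emeasure_density nn_integral_cmult)
  also have "\<dots> = 1" using cdf_std_normal_uminus[of 0] by (simp add: mult_2)
  finally show "emeasure half_normal (space half_normal) = 1" .
qed

text \<open>Only the sign of this mean matters: the constant is cancelled when \<delta> is recovered
  from the means.\<close>

lemma integral_half_normal_pos: "(\<integral>u. u \<partial>half_normal) > 0"
proof -
  have dens: "half_normal = density lborel (\<lambda>u. ennreal (2 * (std_normal_density u * indicator {0<..} u)))"
    unfolding half_normal_def by (intro arg_cong2[where f=density] refl ext) (simp add: ennreal_mult'' indicator_def)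
  let ?g = "\<lambda>u. 2 * (std_normal_density u * indicator {0<..} u) * u"
  have eq: "(\<integral>u. u \<partial>half_normal) = (\<integral>u. ?g u \<partial>lborel)"
    unfolding dens by (subst integral_density) auto
  have int: "integrable lborel ?g"
  proof (rule Bochner_Integration.integrable_bound)
    show "integrable lborel (\<lambda>u. 2 * (std_normal_density u * u))"
      by (intro integrable_mult_right integrable_normal_moment_nz_1) simp
    show "AE u in lborel. norm (?g u) \<le> norm (2 * (std_normal_density u * u))"
      by (rule AE_I2) (simp add: indicator_def)
  qed simp
  have nn: "AE u in lborel. 0 \<le> ?g u"
    by (rule AE_I2) (simp add: indicator_def)
  have "(\<integral>u. ?g u \<partial>lborel) \<noteq> 0"
  proof
    assume "(\<integral>u. ?g u \<partial>lborel) = 0"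
    then have "AE u in lborel. ?g u = 0" using integral_nonneg_eq_0_iff_AE[OF int nn] by simp
    then have "AE u in lborel. u \<notin> {0<..<(1::real)}"
    proof eventually_elim
      case (elim u)
      then show ?case using normal_density_pos[of 1 0 u] by (auto simp: indicator_def)
    qed
    then have "emeasure lborel {0<..<(1::real)} = 0"
      by (subst (asm) AE_iff_measurable[of "{0<..<1}"]) auto
    then show False by simp
  qed
  moreover have "(\<integral>u. ?g u \<partial>lborel) \<ge> 0" using nn by (rule integral_nonneg_AE)
  ultimately show ?thesis unfolding eq by simp
qed

lemma nn_integral_square_normal_density:
  assumes s: "s > 0"
  shows "(\<integral>\<^sup>+u. ennreal (u\<^sup>2) * ennreal (normal_density m s u) \<partial>lborel) = ennreal (s\<^sup>2 + m\<^sup>2)"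
proof -
  have 2: "has_bochner_integral lborel (\<lambda>u. normal_density m s u * (u - m)\<^sup>2) (s\<^sup>2)"
    using normal_moment_even[OF s, of m 1] by (simp add: fact_numeral)
  have 1: "has_bochner_integral lborel (\<lambda>u. 2 * m * (normal_density m s u * (u - m))) (2 * m * 0)"
    using normal_moment_odd[OF s, of m 0] by (intro has_bochner_integral_mult_right) simp
  have 0: "has_bochner_integral lborel (\<lambda>u. m\<^sup>2 * normal_density m s u) (m\<^sup>2 * 1)"
    using normal_moment_even[OF s, of m 0] by (intro has_bochner_integral_mult_right) simp
  have "normal_density m s u * (u - m)\<^sup>2 + (2 * m * (normal_density m s u * (u - m)) + m\<^sup>2 * normal_density m s u) =
      u\<^sup>2 * normal_density m s u" for u
    by (simp add: power2_eq_square algebra_simps)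
  then have "has_bochner_integral lborel (\<lambda>u. u\<^sup>2 * normal_density m s u) (s\<^sup>2 + m\<^sup>2)"
    using has_bochner_integral_add[OF 2 has_bochner_integral_add[OF 1 0]] by simp
  then have "(\<integral>\<^sup>+u. ennreal (u\<^sup>2 * normal_density m s u) \<partial>lborel) = ennreal (s\<^sup>2 + m\<^sup>2)"
    by (simp add: has_bochner_integral_iff nn_integral_eq_integral)
  then show ?thesis by (simp add: ennreal_mult')
qed

text \<open>The second moment is read off \<open>nn_integral_gauss_downdate\<close> for \<open>u\<^sup>2\<close>: its unconditional mean is 1,
  and its conditional mean is a constant plus a multiple of \<open>(x \<bullet> z)\<^sup>2\<close> when \<open>v\<close> is proportional to \<open>S x\<close>.\<close>

lemma nn_integral_gaussian_square:
  fixes S :: "real^'m^'m"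
  assumes S: "positive_definite S"
  shows "(\<integral>\<^sup>+z. ennreal ((x \<bullet> z)\<^sup>2) \<partial>gaussian S) = ennreal (x \<bullet> (S *v x))"
proof -
  let ?a = "x \<bullet> (S *v x)"
  have a: "0 \<le> ?a" by (rule positive_definite_nonneg[OF S])
  \<comment> \<open>Chosen so that the multiple v of S x is admissible for every x: its quadratic
    form is a / (1 + a), which is below 1.\<close>
  define t where "t = 1 / sqrt (1 + ?a)"
  have t: "t > 0" "t\<^sup>2 = 1 / (1 + ?a)" using a by (simp_all add: t_def power_divide)
  define v where "v = t *\<^sub>R (S *v x)"
  note c = matrix_inv_vector_cancel[OF S]
  have q: "v \<bullet> (matrix_inv S *v v) = t\<^sup>2 * ?a"
    by (simp add: v_def matrix_vector_mult_scaleR c power2_eq_square inner_commute)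
  have q1: "t\<^sup>2 * ?a < 1" using a unfolding t(2) by simp
  have vz: "v \<bullet> (matrix_inv S *v z) = t * (x \<bullet> z)" for z
    using positive_definite_sym[OF S, of "matrix_inv S *v z" x] by (simp add: v_def c inner_commute)
  have B: "positive_definite (S - outer_square v)"
    using sn_admissible_iff_positive_definite[OF S, of v] q q1 by (simp add: sn_admissible_def)
  let ?s = "sqrt (1 - t\<^sup>2 * ?a)"
  have s: "?s > 0" "?s\<^sup>2 = 1 - t\<^sup>2 * ?a" using q1 by simp_all
  let ?I = "\<integral>\<^sup>+z. ennreal ((x \<bullet> z)\<^sup>2) \<partial>gaussian S"
  have "(\<integral>\<^sup>+z. gauss_density S z * (\<integral>\<^sup>+u. ennreal (u\<^sup>2) * normal_density (t * (x \<bullet> z)) ?s u \<partial>lborel) \<partial>lborel) =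
      (\<integral>\<^sup>+u. std_normal_density u * (\<integral>\<^sup>+w. ennreal (u\<^sup>2) * gauss_density (S - outer_square v) w \<partial>lborel) \<partial>lborel)"
    using nn_integral_gauss_downdate[OF S B, of "\<lambda>z u. ennreal (u\<^sup>2)"] unfolding q unfolding vz by measurable
  also have "\<dots> = (\<integral>\<^sup>+u. ennreal (u\<^sup>2) * std_normal_density u \<partial>lborel)"
    by (simp add: nn_integral_cmult nn_integral_gauss_density[OF B] mult.commute)
  also have "\<dots> = 1" by (subst nn_integral_square_normal_density) simp_all
  also have "(\<integral>\<^sup>+z. gauss_density S z * (\<integral>\<^sup>+u. ennreal (u\<^sup>2) * normal_density (t * (x \<bullet> z)) ?s u \<partial>lborel) \<partial>lborel) =
      (\<integral>\<^sup>+z. ennreal (?s\<^sup>2) * gauss_density S z + ennreal (t\<^sup>2) * (ennreal ((x \<bullet> z)\<^sup>2) * gauss_density S z) \<partial>lborel)"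
    unfolding nn_integral_square_normal_density[OF s(1)]
    by (intro nn_integral_cong)
      (simp add: ennreal_plus ennreal_mult' power_mult_distrib distrib_left mult_ac del: real_sqrt_pow2_iff)
  also have "\<dots> = ennreal (?s\<^sup>2) + ennreal (t\<^sup>2) * ?I"
    by (simp add: nn_integral_add nn_integral_cmult nn_integral_gauss_density[OF S] nn_integral_gaussian[OF S]
        del: real_sqrt_pow2_iff)
  \<comment> \<open>Splitting the same total with the claimed value in place of \<open>?I\<close>
    lets the finite first summand cancel.\<close>
  also have "1 = ennreal (?s\<^sup>2) + ennreal (t\<^sup>2) * ennreal ?a"
    unfolding s(2) using a q1 by (simp add: ennreal_mult'[symmetric] ennreal_plus[symmetric] del: ennreal_plus)
  finally have "ennreal (t\<^sup>2) * ?I = ennreal (t\<^sup>2) * ennreal ?a"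
    by (simp add: ennreal_add_left_cancel)
  then show ?thesis using t(1) by (simp add: ennreal_mult_cancel_left)
qed

lemma gaussian_mean_zero:
  fixes S :: "real^'m^'m"
  assumes S: "positive_definite S"
  shows "(\<integral>z. z $ i \<partial>gaussian S) = 0"
proof -
  have refl: "distr (gaussian S) borel uminus = gaussian S"
  proof (rule measure_eqI)
    fix X assume "X \<in> sets (distr (gaussian S) borel uminus)"
    then have [measurable]: "X \<in> sets borel" by simp
    have "emeasure (distr (gaussian S) borel uminus) X = (\<integral>\<^sup>+z. indicator X (- z) \<partial>gaussian S)"
      by (subst nn_integral_indicator[symmetric], simp, subst nn_integral_distr) auto
    also have "\<dots> = (\<integral>\<^sup>+z. (indicator X z :: ennreal) * gauss_density S z \<partial>lborel)"
      using nn_integral_lborel_uminus[of "\<lambda>z. (indicator X z :: ennreal) * gauss_density S z"]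
      by (simp add: nn_integral_gaussian[OF S])
    also have "\<dots> = (\<integral>\<^sup>+z. indicator X z \<partial>gaussian S)"
      by (simp add: nn_integral_gaussian[OF S] del: nn_integral_indicator)
    finally show "emeasure (distr (gaussian S) borel uminus) X = emeasure (gaussian S) X" by simp
  qed simp
  have "(\<integral>z. z $ i \<partial>gaussian S) = (\<integral>z. z $ i \<partial>distr (gaussian S) borel uminus)" by (simp add: refl)
  also have "\<dots> = - (\<integral>z. z $ i \<partial>gaussian S)" by (subst integral_distr) simp_all
  finally show ?thesis by simp
qed

lemma gaussian_component_integrable:
  fixes S :: "real^'m^'m"
  assumes S: "positive_definite S"
  shows "integrable (gaussian S) (\<lambda>z. z $ i)"
proof -
  interpret prob_space "gaussian S" by (rule prob_space_gaussian[OF S])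
  have "integrable (gaussian S) (\<lambda>z. (z $ i)\<^sup>2)"
    using nn_integral_gaussian_square[OF S, of "axis i 1"]
    by (intro integrableI_nonneg) (simp_all add: inner_axis')
  then show ?thesis by (rule square_integrable_imp_integrable[rotated]) measurable
qed

section \<open>Mixture representation and moments of the skew-normal law\<close>

locale skew_normal_vector = prob_space P for P :: "'a measure" +
  fixes Z :: "'a \<Rightarrow> real^'m" and \<Omega> :: "real^'m^'m" and \<delta> :: "real^'m"
  assumes pd: "positive_definite \<Omega>" and unit_diag: "\<And>i. \<Omega> $ i $ i = 1"
    and admissible: "sn_admissible \<Omega> \<delta>"
    and dist: "distributed P lborel Z (\<lambda>z. ennreal (sn_density 0 \<Omega> (sn_alpha \<Omega> \<delta>) z))"
begin

lemma pd_residual: "positive_definite (\<Omega> - outer_square \<delta>)"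
  using admissible sn_admissible_iff_positive_definite[OF pd] by blast

lemma measurable_Z [measurable]: "Z \<in> borel_measurable P"
  using distributed_measurable[OF dist] by simp

lemma density_eq:
  "ennreal (sn_density 0 \<Omega> (sn_alpha \<Omega> \<delta>) z) = 2 * (ennreal (gauss_density \<Omega> z) *
    ennreal (cdf std_normal_distribution (sn_alpha \<Omega> \<delta> \<bullet> z)))"
proof -
  interpret N: real_distribution std_normal_distribution by (rule real_dist_normal_dist)
  show ?thesis
    by (subst sn_density_eq[OF prob_space_axioms pd unit_diag dist])
      (simp add: ennreal_mult' ennreal_mult'' N.cdf_nonneg gauss_density_nonneg[OF pd] mult_ac)
qed

lemma nn_integral_Z:
  assumes [measurable]: "F \<in> borel_measurable borel"
  shows "(\<integral>\<^sup>+x. F (Z x) \<partial>P) = 2 * (\<integral>\<^sup>+z. F z * gauss_density \<Omega> z *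
    ennreal (cdf std_normal_distribution (sn_alpha \<Omega> \<delta> \<bullet> z)) \<partial>lborel)"
  using distributed_nn_integral[OF dist, of F]
  by (simp add: density_eq nn_integral_cmult[symmetric] mult_ac)

lemma nn_integral_Z_even:
  assumes [measurable]: "F \<in> borel_measurable borel" and "\<And>z. F (- z) = F z"
  shows "(\<integral>\<^sup>+x. F (Z x) \<partial>P) = (\<integral>\<^sup>+z. F z \<partial>gaussian \<Omega>)"
  unfolding nn_integral_Z[OF assms(1)] nn_integral_gaussian[OF pd assms(1)]
  by (rule nn_integral_even_skew) (simp_all add: assms(2))

text \<open>The argument of \<Phi> is recognised as mean over standard deviation of the law of u
  given z.\<close>

lemma sn_alpha_inner:
  "sn_alpha \<Omega> \<delta> \<bullet> z = (\<delta> \<bullet> (matrix_inv \<Omega> *v z)) / sqrt (1 - \<delta> \<bullet> (matrix_inv \<Omega> *v \<delta>))"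
  using positive_definite_sym[OF positive_definite_matrix_inv[OF pd], of z \<delta>]
  by (simp add: sn_alpha_def scale_diag_unit[OF unit_diag] inner_commute)

text \<open>The disintegration is applied to twice the indicator of X in z times the indicator of u
  > 0. Integrating the conditional law of u over the positive half-line produces the skew-normal
  density; the other side is the half-normal mixture.\<close>

lemma law:
  "distr P borel Z = distr (half_normal \<Otimes>\<^sub>M gaussian (\<Omega> - outer_square \<delta>)) borel (\<lambda>(u, w). w + u *\<^sub>R \<delta>)"
  (is "_ = distr (_ \<Otimes>\<^sub>M gaussian ?B) borel ?f")
proof (rule measure_eqI)
  fix X assume "X \<in> sets (distr P borel Z)"
  then have [measurable]: "X \<in> sets borel" by simp
  interpret G: prob_space "gaussian ?B" by (rule prob_space_gaussian[OF pd_residual])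
  interpret H: prob_space half_normal by (rule prob_space_half_normal)
  interpret HG: pair_prob_space half_normal "gaussian ?B" ..
  let ?q = "\<delta> \<bullet> (matrix_inv \<Omega> *v \<delta>)"
  have s: "sqrt (1 - ?q) > 0" using admissible by (simp add: sn_admissible_def)
  let ?F = "indicator X :: _ \<Rightarrow> ennreal"
  have "emeasure (distr P borel Z) X = (\<integral>\<^sup>+z. ?F z \<partial>distr P borel Z)" by simp
  also have "\<dots> = (\<integral>\<^sup>+x. ?F (Z x) \<partial>P)" by (subst nn_integral_distr) auto
  also have "\<dots> = (\<integral>\<^sup>+z. gauss_density \<Omega> z * (\<integral>\<^sup>+u. (2 * ?F z * indicator {0<..} u) *
       normal_density (\<delta> \<bullet> (matrix_inv \<Omega> *v z)) (sqrt (1 - ?q)) u \<partial>lborel) \<partial>lborel)"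
  proof -
    have "(\<integral>\<^sup>+u. (2 * ?F z * indicator {0<..} u) * normal_density (\<delta> \<bullet> (matrix_inv \<Omega> *v z)) (sqrt (1 - ?q)) u \<partial>lborel) =
      2 * ?F z * ennreal (cdf std_normal_distribution (sn_alpha \<Omega> \<delta> \<bullet> z))" for z
      unfolding sn_alpha_inner nn_integral_normal_density_positive[OF s, symmetric]
      by (subst nn_integral_cmult[symmetric]) (simp_all add: mult_ac)
    then show ?thesis
      unfolding nn_integral_Z[OF borel_measurable_indicator[OF \<open>X \<in> sets borel\<close>]]
      by (subst nn_integral_cmult[symmetric]) (simp_all add: mult_ac)
  qed
  also have "\<dots> = (\<integral>\<^sup>+u. std_normal_density u * (\<integral>\<^sup>+w. (2 * ?F (w + u *\<^sub>R \<delta>) * indicator {0<..} u) *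
      gauss_density ?B w \<partial>lborel) \<partial>lborel)"
    using nn_integral_gauss_downdate[OF pd pd_residual, of "\<lambda>z u. 2 * ?F z * indicator {0<..} u"] by simp
  also have "\<dots> = (\<integral>\<^sup>+u. 2 * (ennreal (std_normal_density u) * indicator {0<..} u) *
      (\<integral>\<^sup>+w. ?F (w + u *\<^sub>R \<delta>) \<partial>gaussian ?B) \<partial>lborel)"
  proof (rule nn_integral_cong)
    fix u
    have "(\<integral>\<^sup>+w. (2 * ?F (w + u *\<^sub>R \<delta>) * indicator {0<..} u) * gauss_density ?B w \<partial>lborel) =
      (2 * indicator {0<..} u) * (\<integral>\<^sup>+w. ?F (w + u *\<^sub>R \<delta>) * gauss_density ?B w \<partial>lborel)"
      by (subst nn_integral_cmult[symmetric]) (simp_all add: mult_ac)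
    then show "std_normal_density u * (\<integral>\<^sup>+w. (2 * ?F (w + u *\<^sub>R \<delta>) * indicator {0<..} u) *
        gauss_density ?B w \<partial>lborel) =
      2 * (ennreal (std_normal_density u) * indicator {0<..} u) *
      (\<integral>\<^sup>+w. ?F (w + u *\<^sub>R \<delta>) \<partial>gaussian ?B)"
      by (subst nn_integral_gaussian[OF pd_residual]) (simp_all add: mult_ac)
  qed
  also have "\<dots> = (\<integral>\<^sup>+u. (\<integral>\<^sup>+w. ?F (?f (u, w)) \<partial>gaussian ?B) \<partial>half_normal)"
    unfolding half_normal_def by (subst nn_integral_density) simp_all
  also have "\<dots> = (\<integral>\<^sup>+p. ?F (?f p) \<partial>(half_normal \<Otimes>\<^sub>M gaussian ?B))"
    by (rule G.nn_integral_fst) measurable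
  also have "\<dots> = (\<integral>\<^sup>+z. ?F z \<partial>distr (half_normal \<Otimes>\<^sub>M gaussian ?B) borel ?f)"
    by (subst nn_integral_distr) auto
  also have "\<dots> = emeasure (distr (half_normal \<Otimes>\<^sub>M gaussian ?B) borel ?f) X" by simp
  finally show "emeasure (distr P borel Z) X = emeasure (distr (half_normal \<Otimes>\<^sub>M gaussian ?B) borel ?f) X" .
qed simp

lemma integrable_Z_iff:
  fixes F :: "real^'m \<Rightarrow> real"
  assumes [measurable]: "F \<in> borel_measurable borel"
  shows "integrable P (\<lambda>x. F (Z x)) \<longleftrightarrow>
    integrable (half_normal \<Otimes>\<^sub>M gaussian (\<Omega> - outer_square \<delta>)) (\<lambda>(u, w). F (w + u *\<^sub>R \<delta>))"
proof -
  have "integrable P (\<lambda>x. F (Z x)) \<longleftrightarrow> integrable (distr P borel Z) F"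
    by (subst integrable_distr_eq) simp_all
  also have "\<dots> \<longleftrightarrow> integrable (half_normal \<Otimes>\<^sub>M gaussian (\<Omega> - outer_square \<delta>)) (\<lambda>(u, w). F (w + u *\<^sub>R \<delta>))"
    unfolding law by (subst integrable_distr_eq) (simp_all add: split_beta')
  finally show ?thesis .
qed

lemma integral_Z:
  fixes F :: "real^'m \<Rightarrow> real"
  assumes [measurable]: "F \<in> borel_measurable borel"
  shows "(\<integral>x. F (Z x) \<partial>P) =
    (\<integral>p. (case p of (u, w) \<Rightarrow> F (w + u *\<^sub>R \<delta>)) \<partial>(half_normal \<Otimes>\<^sub>M gaussian (\<Omega> - outer_square \<delta>)))"
proof -
  have "(\<integral>x. F (Z x) \<partial>P) = (\<integral>z. F z \<partial>distr P borel Z)"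
    by (subst integral_distr) simp_all
  also have "\<dots> = (\<integral>p. (case p of (u, w) \<Rightarrow> F (w + u *\<^sub>R \<delta>)) \<partial>(half_normal \<Otimes>\<^sub>M gaussian (\<Omega> - outer_square \<delta>)))"
    unfolding law by (subst integral_distr) (simp_all add: split_beta')
  finally show ?thesis .
qed

lemma second_moment:
  "integrable P (\<lambda>x. (y \<bullet> Z x)\<^sup>2)" "(\<integral>x. (y \<bullet> Z x)\<^sup>2 \<partial>P) = y \<bullet> (\<Omega> *v y)"
proof -
  have nn: "(\<integral>\<^sup>+x. ennreal ((y \<bullet> Z x)\<^sup>2) \<partial>P) = ennreal (y \<bullet> (\<Omega> *v y))"
    using nn_integral_Z_even[of "\<lambda>z. ennreal ((y \<bullet> z)\<^sup>2)"] nn_integral_gaussian_square[OF pd] by simp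
  show int: "integrable P (\<lambda>x. (y \<bullet> Z x)\<^sup>2)"
    by (rule integrableI_nonneg) (simp_all add: nn)
  then show "(\<integral>x. (y \<bullet> Z x)\<^sup>2 \<partial>P) = y \<bullet> (\<Omega> *v y)"
    using nn by (simp add: nn_integral_eq_integral positive_definite_nonneg[OF pd])
qed

text \<open>Products of two coordinates are even, so their expectations are the Gaussian ones;
  polarisation passes from squares to products.\<close>

lemma product_moment:
  "integrable P (\<lambda>x. Z x $ i * Z x $ j)" "(\<integral>x. Z x $ i * Z x $ j \<partial>P) = \<Omega> $ i $ j"
proof -
  have sym: "\<Omega> $ j $ i = \<Omega> $ i $ j"
  proof -
    have "transpose \<Omega> $ i $ j = \<Omega> $ i $ j" using pd by (simp add: positive_definite_def)
    then show ?thesis by (simp add: transpose_def)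
  qed
  let ?i = "axis i 1 :: real^'m" and ?j = "axis j 1 :: real^'m"
  have eq: "Z x $ i * Z x $ j = (((?i + ?j) \<bullet> Z x)\<^sup>2 - (?i \<bullet> Z x)\<^sup>2 - (?j \<bullet> Z x)\<^sup>2) / 2" for x
    by (simp add: inner_add_left inner_axis' power2_sum)
  have form: "axis a 1 \<bullet> (\<Omega> *v axis b 1) = \<Omega> $ a $ b" for a b
    by (simp add: inner_axis' matrix_vector_mult_basis column_def)
  have m: "has_bochner_integral P (\<lambda>x. (y \<bullet> Z x)\<^sup>2) (y \<bullet> (\<Omega> *v y))" for y
    using second_moment[of y] by (simp add: has_bochner_integral_iff)
  have "((?i + ?j) \<bullet> (\<Omega> *v (?i + ?j)) - ?i \<bullet> (\<Omega> *v ?i) - ?j \<bullet> (\<Omega> *v ?j)) / 2 = \<Omega> $ i $ j"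
    unfolding matrix_vector_right_distrib inner_add_left inner_add_right form using sym by simp
  moreover have "has_bochner_integral P (\<lambda>x. (((?i + ?j) \<bullet> Z x)\<^sup>2 - (?i \<bullet> Z x)\<^sup>2 - (?j \<bullet> Z x)\<^sup>2) / 2)
      (((?i + ?j) \<bullet> (\<Omega> *v (?i + ?j)) - ?i \<bullet> (\<Omega> *v ?i) - ?j \<bullet> (\<Omega> *v ?j)) / 2)"
    by (intro has_bochner_integral_divide_zero has_bochner_integral_diff m)
  ultimately have "has_bochner_integral P (\<lambda>x. Z x $ i * Z x $ j) (\<Omega> $ i $ j)"
    unfolding eq by simp
  then show "integrable P (\<lambda>x. Z x $ i * Z x $ j)" "(\<integral>x. Z x $ i * Z x $ j \<partial>P) = \<Omega> $ i $ j"
    by (simp_all only: has_bochner_integral_iff)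
qed

lemma integrable_component: "integrable P (\<lambda>x. Z x $ i)"
proof (rule square_integrable_imp_integrable)
  show "integrable P (\<lambda>x. (Z x $ i)\<^sup>2)"
    using product_moment(1)[of i i] by (simp only: power2_eq_square)
qed measurable

text \<open>Given u, the Gaussian part is centred. The factor depends neither on \<Omega> nor on
  \<delta>, so the means identify \<delta>.\<close>

lemma mean: "(\<integral>x. Z x $ i \<partial>P) = (\<integral>u. u \<partial>half_normal) * \<delta> $ i"
proof -
  let ?B = "\<Omega> - outer_square \<delta>"
  interpret G: prob_space "gaussian ?B" by (rule prob_space_gaussian[OF pd_residual])
  interpret H: prob_space half_normal by (rule prob_space_half_normal)
  interpret HG: pair_prob_space half_normal "gaussian ?B" ..
  let ?f = "\<lambda>(u, w). (w + u *\<^sub>R \<delta>) $ i"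
  have int: "integrable (half_normal \<Otimes>\<^sub>M gaussian ?B) ?f"
    using integrable_Z_iff[of "\<lambda>z. z $ i"] integrable_component by simp
  have "(\<integral>x. Z x $ i \<partial>P) = (\<integral>u. (\<integral>w. ?f (u, w) \<partial>gaussian ?B) \<partial>half_normal)"
    unfolding HG.integral_fst'[OF int] using integral_Z[of "\<lambda>z. z $ i"] by simp
  also have "\<dots> = (\<integral>u. u * \<delta> $ i \<partial>half_normal)"
    using gaussian_mean_zero[OF pd_residual] gaussian_component_integrable[OF pd_residual] G.prob_space
    by simp
  finally show ?thesis by simp
qed

end

text \<open>Given u, both vectors are Gaussian with the same shift u \<delta>. Subtracting the same
  \<delta> \<delta>^T from both scale matrices preserves the equal diagonals and the entrywise
  order.\<close>

lemma supermodular_skew_normal: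
  fixes F :: "real^'m \<Rightarrow> real"
  assumes X: "skew_normal_vector P X \<Omega> \<delta>" and Y: "skew_normal_vector Q Y \<Omega>' \<delta>"
    and le: "\<And>i j. \<Omega> $ i $ j \<le> \<Omega>' $ i $ j"
    and F: "supermodular_vec F" and [measurable]: "F \<in> borel_measurable borel"
    and int: "integrable P (\<lambda>x. F (X x))" "integrable Q (\<lambda>y. F (Y y))"
  shows "(\<integral>x. F (X x) \<partial>P) \<le> (\<integral>y. F (Y y) \<partial>Q)"
proof -
  interpret X: skew_normal_vector P X \<Omega> \<delta> by (rule X)
  interpret Y: skew_normal_vector Q Y \<Omega>' \<delta> by (rule Y)
  let ?B = "\<Omega> - outer_square \<delta>" and ?C = "\<Omega>' - outer_square \<delta>"
  interpret B: prob_space "gaussian ?B" by (rule prob_space_gaussian[OF X.pd_residual])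
  interpret C: prob_space "gaussian ?C" by (rule prob_space_gaussian[OF Y.pd_residual])
  interpret H: prob_space half_normal by (rule prob_space_half_normal)
  interpret HB: pair_prob_space half_normal "gaussian ?B" ..
  interpret HC: pair_prob_space half_normal "gaussian ?C" ..
  let ?f = "\<lambda>(u, w). F (w + u *\<^sub>R \<delta>)"
  have intB: "integrable (half_normal \<Otimes>\<^sub>M gaussian ?B) ?f"
    using int(1) by (simp add: X.integrable_Z_iff)
  have intC: "integrable (half_normal \<Otimes>\<^sub>M gaussian ?C) ?f"
    using int(2) by (simp add: Y.integrable_Z_iff)
  have "(\<integral>u. (\<integral>w. ?f (u, w) \<partial>gaussian ?B) \<partial>half_normal) \<le> (\<integral>u. (\<integral>w. ?f (u, w) \<partial>gaussian ?C) \<partial>half_normal)"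
  proof (rule integral_mono_AE)
    show "integrable half_normal (\<lambda>u. \<integral>w. ?f (u, w) \<partial>gaussian ?B)" by (rule HB.integrable_fst'[OF intB])
    show "integrable half_normal (\<lambda>u. \<integral>w. ?f (u, w) \<partial>gaussian ?C)" by (rule HC.integrable_fst'[OF intC])
    \<comment> \<open>Fubini grants integrability of the sections for almost every u only, and the
      Gaussian comparison needs it on both sides.\<close>
    show "AE u in half_normal. (\<integral>w. ?f (u, w) \<partial>gaussian ?B) \<le> (\<integral>w. ?f (u, w) \<partial>gaussian ?C)"
      using HB.AE_integrable_fst'[OF intB] HC.AE_integrable_fst'[OF intC]
    proof eventually_elim
      case (elim u)
      have sm: "supermodular_vec (\<lambda>w. F (w + u *\<^sub>R \<delta>))"
        unfolding supermodular_vec_def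
      proof (intro allI impI)
        fix x :: "real^'m" and i j :: 'm and \<epsilon> \<eta> :: real
        assume "i \<noteq> j" "0 \<le> \<epsilon>" "0 \<le> \<eta>"
        from supermodular_vecD[OF F this, of "x + u *\<^sub>R \<delta>"]
        show "F (x + \<epsilon> *\<^sub>R axis i 1 + u *\<^sub>R \<delta>) + F (x + \<eta> *\<^sub>R axis j 1 + u *\<^sub>R \<delta>) \<le>
          F (x + \<epsilon> *\<^sub>R axis i 1 + \<eta> *\<^sub>R axis j 1 + u *\<^sub>R \<delta>) + F (x + u *\<^sub>R \<delta>)"
          by (simp add: add_ac)
      qed
      show ?case
        using supermodular_gaussian[OF X.pd_residual Y.pd_residual _ _ sm] elim le
        by (simp add: X.unit_diag Y.unit_diag)
    qed
  qed
  then show ?thesis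
    unfolding HB.integral_fst'[OF intB] HC.integral_fst'[OF intC]
    by (simp add: X.integral_Z Y.integral_Z)
qed

section \<open>Matrix variate skew-normal laws\<close>

lemma unit_matrix_nth: "unit_matrix k j $ a $ b = of_bool (k = a \<and> j = b)"
  by (simp add: unit_matrix_def axis_def)

lemma borel_measurable_entry [measurable]: "(\<lambda>X :: real^'p^'n. X $ k $ j) \<in> borel_measurable borel"
  by (intro borel_measurable_continuous_onI continuous_intros)

lemma borel_measurable_vec_unstack [measurable]: "vec_unstack \<in> borel_measurable borel"
  unfolding vec_unstack_def[abs_def] by (intro borel_measurable_continuous_onI continuous_intros)

lemma supermodular_vec_unstack:
  fixes f :: "real^'p^'n \<Rightarrow> real"
  assumes f: "supermodular f"
  shows "supermodular_vec (\<lambda>z. f (vec_unstack z))"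
  unfolding supermodular_vec_def
proof (intro allI impI)
  fix x :: "real^('p \<times> 'n)" and i j :: "'p \<times> 'n" and \<epsilon> \<eta> :: real
  assume ij: "i \<noteq> j" and pos: "0 \<le> \<epsilon>" "0 \<le> \<eta>"
  have add: "vec_unstack (z + c *\<^sub>R axis k 1) = vec_unstack z + c *\<^sub>R unit_matrix (snd k) (fst k)"
    for z :: "real^('p \<times> 'n)" and c k
    by (cases k) (auto simp: vec_unstack_def unit_matrix_nth vec_eq_iff axis_def)
  let ?X = "vec_unstack x" and ?E = "unit_matrix (snd i) (fst i)" and ?E' = "unit_matrix (snd j) (fst j)"
  have "f (?X + \<epsilon> *\<^sub>R ?E) + f (?X + \<eta> *\<^sub>R ?E') \<le> f (?X + \<epsilon> *\<^sub>R ?E + \<eta> *\<^sub>R ?E') + f ?X"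
  \<comment> \<open>With a zero increment both sides agree; the definition for matrices speaks of
    positive increments only.\<close>
  proof (cases "\<epsilon> = 0 \<or> \<eta> = 0")
    case False
    with pos have "\<epsilon> > 0" "\<eta> > 0" by auto
    moreover have "(snd i, fst i) \<noteq> (snd j, fst j)" using ij by (auto simp: prod_eq_iff)
    ultimately have "entry_diff (snd i) (fst i) \<epsilon> (entry_diff (snd j) (fst j) \<eta> f) ?X \<ge> 0"
      using f unfolding supermodular_def by blast
    then show ?thesis by (simp add: entry_diff_def)
  qed auto
  then show "f (vec_unstack (x + \<epsilon> *\<^sub>R axis i 1)) + f (vec_unstack (x + \<eta> *\<^sub>R axis j 1)) \<le>
      f (vec_unstack (x + \<epsilon> *\<^sub>R axis i 1 + \<eta> *\<^sub>R axis j 1)) + f (vec_unstack x)"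
    by (simp only: add)
qed

text \<open>Of two different entries at least one is not (a, b), so the mixed difference vanishes.
  Hence h and -h are both allowed as test functions.\<close>

lemma supermodular_entry: "supermodular (\<lambda>X :: real^'p^'n. h (X $ a $ b))"
  unfolding supermodular_def
proof (intro allI impI)
  fix X :: "real^'p^'n" and k l :: 'n and i j :: 'p and \<epsilon> \<eta> :: real
  assume "(k, i) \<noteq> (l, j)"
  then have "(k, i) \<noteq> (a, b) \<or> (l, j) \<noteq> (a, b)" by auto
  then show "0 \<le> entry_diff k i \<epsilon> (entry_diff l j \<eta> (\<lambda>X. h (X $ a $ b))) X"
    by (auto simp: entry_diff_def unit_matrix_nth)
qed

text \<open>The mixed difference of a product of two linear functions is \<epsilon> \<eta> times the
  symmetrised product of their coefficients, which are 0 or 1 here.\<close>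

lemma supermodular_entry_mult: "supermodular (\<lambda>X :: real^'p^'n. X $ a $ b * X $ c $ d)"
  unfolding supermodular_def
proof (intro allI impI)
  fix X :: "real^'p^'n" and k l :: 'n and i j :: 'p and \<epsilon> \<eta> :: real
  assume "\<epsilon> > 0" "\<eta> > 0"
  let ?E = "unit_matrix k i :: real^'p^'n" and ?E' = "unit_matrix l j :: real^'p^'n"
  have "entry_diff k i \<epsilon> (entry_diff l j \<eta> (\<lambda>X. X $ a $ b * X $ c $ d)) X =
      \<epsilon> * \<eta> * (?E $ a $ b * ?E' $ c $ d + ?E' $ a $ b * ?E $ c $ d)"
    by (simp add: entry_diff_def algebra_simps)
  then show "0 \<le> entry_diff k i \<epsilon> (entry_diff l j \<eta> (\<lambda>X. X $ a $ b * X $ c $ d)) X"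
    using \<open>\<epsilon> > 0\<close> \<open>\<eta> > 0\<close> by (simp add: unit_matrix_nth)
qed

lemma positive_definite_diag_pos:
  assumes "positive_definite A"
  shows "A $ i $ i > 0"
proof -
  have "axis i 1 \<bullet> (A *v axis i 1) > 0"
    using assms unfolding positive_definite_def by (metis axis_eq_0_iff zero_neq_one)
  then show ?thesis by (simp add: inner_axis' matrix_vector_mult_basis column_def)
qed

lemma matrix_skew_normal_star_vector:
  fixes X :: "'a \<Rightarrow> real^'p^'n"
  assumes P: "prob_space P" and unit: "\<And>i. C $ i $ i = 1"
    and X: "matrix_skew_normal_star P X 0 C \<delta>"
  shows "skew_normal_vector P (\<lambda>w. vec_stack (X w)) C \<delta>"
proof -
  have "vec_stack (0 :: real^'p^'n) = 0" by (simp add: vec_stack_def vec_eq_iff)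
  then show ?thesis
    using assms
    unfolding matrix_skew_normal_star_def matrix_skew_normal_def skew_normal_def
      skew_normal_vector_def skew_normal_vector_axioms_def by simp
qed

text \<open>The indicator of a Borel set of one entry and its negative are bounded supermodular
  functions; together they force equal probabilities.\<close>

lemma supermodular_le_same_marginals:
  assumes P: "prob_space P" and Q: "prob_space Q"
    and X: "\<And>k j. (\<lambda>w. X w $ k $ j) \<in> borel_measurable P"
    and Y: "\<And>k j. (\<lambda>w. Y w $ k $ j) \<in> borel_measurable Q"
    and le: "supermodular_le P X Q Y"
  shows "same_marginals P X Q Y"
  unfolding same_marginals_def
proof (intro allI measure_eqI)
  fix k j A
  note [measurable] = X Y
  interpret P: prob_space P by (rule P)
  interpret Q: prob_space Q by (rule Q)
  let ?X = "\<lambda>w. X w $ k $ j" and ?Y = "\<lambda>w. Y w $ k $ j"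
  assume "A \<in> sets (distr P borel ?X)"
  then have [measurable]: "A \<in> sets borel" by simp
  have ind: "(\<integral>w. indicat_real A (?X w) \<partial>P) = measure (distr P borel ?X) A"
    "(\<integral>w. indicat_real A (?Y w) \<partial>Q) = measure (distr Q borel ?Y) A"
    using integral_distr[of ?X P borel "indicat_real A"] integral_distr[of ?Y Q borel "indicat_real A"]
    by simp_all
  have int: "integrable P (\<lambda>w. indicat_real A (?X w))" "integrable Q (\<lambda>w. indicat_real A (?Y w))"
    by (rule P.integrable_const_bound[where B=1], simp_all, rule Q.integrable_const_bound[where B=1], simp_all)
  have le: "(\<integral>w. h (?X w) \<partial>P) \<le> (\<integral>w. h (?Y w) \<partial>Q)"
    if "h \<in> borel_measurable borel" "integrable P (\<lambda>w. h (?X w))" "integrable Q (\<lambda>w. h (?Y w))" for h :: "real \<Rightarrow> real"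
    by (rule le[unfolded supermodular_le_def, rule_format, OF supermodular_entry])
      (use that in \<open>auto intro: measurable_compose[OF borel_measurable_entry]\<close>)
  have "measure (distr P borel ?X) A = measure (distr Q borel ?Y) A"
    using le[of "indicat_real A"] le[of "\<lambda>x. - indicat_real A x"] int by (simp add: ind)
  then show "emeasure (distr P borel ?X) A = emeasure (distr Q borel ?Y) A"
    using P.prob_space_distr[of ?X borel] Q.prob_space_distr[of ?Y borel]
    by (simp add: prob_space.finite_measure finite_measure.emeasure_eq_measure)
qed simp

theorem theorem5p7:
  fixes P :: "'a measure" and Q :: "'b measure"
    and X0 :: "'a \<Rightarrow> real^'p^'n" and Y0 :: "'b \<Rightarrow> real^'p^'n"
    and V V' :: "real^'p^'p" and S S' :: "real^'n^'n"
    and \<Omega> \<Omega>' :: "real^('p \<times> 'n)^('p \<times> 'n)"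
    and \<delta> \<delta>' :: "real^('p \<times> 'n)"
  assumes "prob_space P" and "prob_space Q"
    and "positive_definite V" and "positive_definite V'"
    and "positive_definite S" and "positive_definite S'"
    and "\<Omega> = kronecker V S" and "\<Omega>' = kronecker V' S'"
    and "matrix_skew_normal_star P X0 0 (correlation_matrix \<Omega>) \<delta>"
    and "matrix_skew_normal_star Q Y0 0 (correlation_matrix \<Omega>') \<delta>'"
  shows "supermodular_le P X0 Q Y0 \<longleftrightarrow>
    same_marginals P X0 Q Y0 \<and>
    (\<forall>i j. correlation_matrix \<Omega> $ i $ j \<le> correlation_matrix \<Omega>' $ i $ j)"
proof -
  let ?C = "correlation_matrix \<Omega>" and ?C' = "correlation_matrix \<Omega>'"
  \<comment> \<open>Diagonal entries of a Kronecker product are products of diagonal entries of the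
    factors.\<close>
  have "\<Omega> $ i $ i > 0" "\<Omega>' $ i $ i > 0" for i
    using assms(3-6) unfolding assms(7,8) by (simp_all add: kronecker_def positive_definite_diag_pos)
  then have unit: "?C $ i $ i = 1" "?C' $ i $ i = 1" for i
    by (simp_all add: correlation_matrix_diag)
  interpret X: skew_normal_vector P "\<lambda>w. vec_stack (X0 w)" ?C \<delta>
    by (rule matrix_skew_normal_star_vector[OF assms(1) unit(1) assms(9)])
  interpret Y: skew_normal_vector Q "\<lambda>w. vec_stack (Y0 w)" ?C' \<delta>'
    by (rule matrix_skew_normal_star_vector[OF assms(2) unit(2) assms(10)])
  have comp: "vec_stack M $ i = M $ snd i $ fst i" for M :: "real^'p^'n" and i
    by (simp add: vec_stack_def)
  have [measurable]: "(\<lambda>w. X0 w $ k $ j) \<in> borel_measurable P" "(\<lambda>w. Y0 w $ k $ j) \<in> borel_measurable Q" for k j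
    using measurable_compose[OF X.measurable_Z borel_measurable_vec_component[of "(j, k)"]]
      measurable_compose[OF Y.measurable_Z borel_measurable_vec_component[of "(j, k)"]]
    by (simp_all add: comp)
  show ?thesis
  proof (intro iffI conjI allI)
    assume le: "supermodular_le P X0 Q Y0"
    show "same_marginals P X0 Q Y0"
      by (rule supermodular_le_same_marginals[OF assms(1,2) _ _ le]) measurable
    fix a b :: "'p \<times> 'n"
    let ?f = "\<lambda>X :: real^'p^'n. X $ snd a $ fst a * X $ snd b $ fst b"
    have "(\<integral>w. ?f (X0 w) \<partial>P) \<le> (\<integral>w. ?f (Y0 w) \<partial>Q)"
      using X.product_moment(1)[of a b] Y.product_moment(1)[of a b]
      by (intro le[unfolded supermodular_le_def, rule_format] supermodular_entry_mult) (simp_all add: comp)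
    then show "?C $ a $ b \<le> ?C' $ a $ b"
      using X.product_moment(2)[of a b] Y.product_moment(2)[of a b] by (simp add: comp)
  next
    assume rhs: "same_marginals P X0 Q Y0 \<and> (\<forall>i j. ?C $ i $ j \<le> ?C' $ i $ j)"
    \<comment> \<open>Equal marginals enter through their means alone, which are one positive
      constant times \<delta> and \<delta>'.\<close>
    have "\<delta> $ i = \<delta>' $ i" for i
    proof -
      let ?k = "snd i" and ?j = "fst i"
      have "(\<integral>w. X0 w $ ?k $ ?j \<partial>P) = (\<integral>x. x \<partial>distr P borel (\<lambda>w. X0 w $ ?k $ ?j))"
        by (subst integral_distr) simp_all
      also have "\<dots> = (\<integral>x. x \<partial>distr Q borel (\<lambda>w. Y0 w $ ?k $ ?j))"
        using rhs by (simp add: same_marginals_def)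
      also have "\<dots> = (\<integral>w. Y0 w $ ?k $ ?j \<partial>Q)"
        by (subst integral_distr) simp_all
      finally have "(\<integral>u. u \<partial>half_normal) * \<delta> $ i = (\<integral>u. u \<partial>half_normal) * \<delta>' $ i"
        using X.mean[of i] Y.mean[of i] by (simp add: comp)
      then show ?thesis using integral_half_normal_pos by simp
    qed
    then have "\<delta>' = \<delta>" by (simp add: vec_eq_iff)
    then have Y: "skew_normal_vector Q (\<lambda>w. vec_stack (Y0 w)) ?C' \<delta>"
      using Y.skew_normal_vector_axioms by simp
    show "supermodular_le P X0 Q Y0"
      unfolding supermodular_le_def
    proof (intro allI impI)
      fix f :: "real^'p^'n \<Rightarrow> real"
      assume f: "supermodular f" "f \<in> borel_measurable borel"
        and int: "integrable P (\<lambda>w. f (X0 w))" "integrable Q (\<lambda>w. f (Y0 w))"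
      show "(\<integral>w. f (X0 w) \<partial>P) \<le> (\<integral>w. f (Y0 w) \<partial>Q)"
        using supermodular_skew_normal[OF X.skew_normal_vector_axioms Y _ supermodular_vec_unstack[OF f(1)]
            measurable_compose[OF borel_measurable_vec_unstack f(2)]] rhs int
        by simp
    qed
  qed
qed

end
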